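(* Let $R$ be a ring with right socle $S_r$. The following are equivalent: (1) $R$ is right $PF$. (2) $R$ is a semilocal, right small injective ring such that $S_r$ is an essential right ideal of $R$.
   Context: Rings are associative with identity. A right ideal $I$ of $R$ is small if $I+K\neq R$ for every proper right ideal $K$ of $R$. $R$ is right small injective if every right $R$-homomorphism from a small right ideal of $R$ to $R_R$ extends to an $R$-homomorphism $R_R\to R_R$. $R$ is semilocal if $R/J$ is semisimple artinian, where $J$ is the Jacobson radical. $R$ is right $PF$ if it is a semiperfect, right self-injective ring whose right socle $S_r$ is essential in $R_R$. *)

theory Defs
  imports "HOL-Algebra.Module" "HOL-Algebra.QuotRing"
begin

section \<open>Right modules\<close>

text \<open>
  The locale \<^verbatim>\<open>module\<close> of HOL-Algebra is confined to commutative scalars; its record type is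
  reused here for right modules over an arbitrary ring.  The field \<^verbatim>\<open>smult\<close> takes the scalar
  first, so \<^verbatim>\<open>r \<odot>\<^bsub>M\<^esub> x\<close> stands for the product written x r on paper.  This is why the
  associativity law exchanges the two scalars.
\<close>

locale right_module = ring R + M: abelian_group M
  for R :: "('a, 'b) ring_scheme" and M :: "('a, 'm, 'c) module_scheme" +
  assumes smult_closed:
      "\<lbrakk>r \<in> carrier R; x \<in> carrier M\<rbrakk> \<Longrightarrow> r \<odot>\<^bsub>M\<^esub> x \<in> carrier M"
    and smult_add_scalar:
      "\<lbrakk>r \<in> carrier R; s \<in> carrier R; x \<in> carrier M\<rbrakk>
        \<Longrightarrow> (r \<oplus>\<^bsub>R\<^esub> s) \<odot>\<^bsub>M\<^esub> x = r \<odot>\<^bsub>M\<^esub> x \<oplus>\<^bsub>M\<^esub> s \<odot>\<^bsub>M\<^esub> x"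
    and smult_add:
      "\<lbrakk>r \<in> carrier R; x \<in> carrier M; y \<in> carrier M\<rbrakk>
        \<Longrightarrow> r \<odot>\<^bsub>M\<^esub> (x \<oplus>\<^bsub>M\<^esub> y) = r \<odot>\<^bsub>M\<^esub> x \<oplus>\<^bsub>M\<^esub> r \<odot>\<^bsub>M\<^esub> y"
    and smult_mult:
      "\<lbrakk>r \<in> carrier R; s \<in> carrier R; x \<in> carrier M\<rbrakk>
        \<Longrightarrow> (r \<otimes>\<^bsub>R\<^esub> s) \<odot>\<^bsub>M\<^esub> x = s \<odot>\<^bsub>M\<^esub> (r \<odot>\<^bsub>M\<^esub> x)"
    and smult_one:
      "x \<in> carrier M \<Longrightarrow> \<one>\<^bsub>R\<^esub> \<odot>\<^bsub>M\<^esub> x = x"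

definition right_submodule ::
  "('a, 'b) ring_scheme \<Rightarrow> ('a, 'm, 'c) module_scheme \<Rightarrow> 'm set \<Rightarrow> bool" where
  "right_submodule R M N \<longleftrightarrow>
     additive_subgroup N M \<and> (\<forall>r\<in>carrier R. \<forall>x\<in>N. r \<odot>\<^bsub>M\<^esub> x \<in> N)"

definition right_hom ::
  "('a, 'b) ring_scheme \<Rightarrow> ('a, 'm, 'c) module_scheme \<Rightarrow> ('a, 'n, 'd) module_scheme
     \<Rightarrow> ('m \<Rightarrow> 'n) set" where
  "right_hom R M N =
     {f \<in> carrier M \<rightarrow> carrier N.
        (\<forall>x\<in>carrier M. \<forall>y\<in>carrier M. f (x \<oplus>\<^bsub>M\<^esub> y) = f x \<oplus>\<^bsub>N\<^esub> f y) \<and>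
        (\<forall>r\<in>carrier R. \<forall>x\<in>carrier M. f (r \<odot>\<^bsub>M\<^esub> x) = r \<odot>\<^bsub>N\<^esub> f x)}"

definition simple_submodule ::
  "('a, 'b) ring_scheme \<Rightarrow> ('a, 'm, 'c) module_scheme \<Rightarrow> 'm set \<Rightarrow> bool" where
  "simple_submodule R M S \<longleftrightarrow>
     right_submodule R M S \<and> S \<noteq> {\<zero>\<^bsub>M\<^esub>} \<and>
     (\<forall>N. right_submodule R M N \<and> N \<subseteq> S \<longrightarrow> N = {\<zero>\<^bsub>M\<^esub>} \<or> N = S)"

text \<open>The sum of all simple submodules, i.e. the least submodule containing each of them.\<close>

definition socle ::
  "('a, 'b) ring_scheme \<Rightarrow> ('a, 'm, 'c) module_scheme \<Rightarrow> 'm set" where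
  "socle R M =
     \<Inter> {N. right_submodule R M N \<and> (\<forall>S. simple_submodule R M S \<longrightarrow> S \<subseteq> N)}"

definition semisimple_module ::
  "('a, 'b) ring_scheme \<Rightarrow> ('a, 'm, 'c) module_scheme \<Rightarrow> bool" where
  "semisimple_module R M \<longleftrightarrow> socle R M = carrier M"

definition essential_submodule ::
  "('a, 'b) ring_scheme \<Rightarrow> ('a, 'm, 'c) module_scheme \<Rightarrow> 'm set \<Rightarrow> bool" where
  "essential_submodule R M N \<longleftrightarrow>
     right_submodule R M N \<and>
     (\<forall>K. right_submodule R M K \<and> K \<noteq> {\<zero>\<^bsub>M\<^esub>} \<longrightarrow> N \<inter> K \<noteq> {\<zero>\<^bsub>M\<^esub>})"

text \<open>Injectivity of E with respect to all right R-modules with elements in the type \<^verbatim>\<open>'m\<close>.\<close>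

definition injective_module ::
  "'m itself \<Rightarrow> ('a, 'b) ring_scheme \<Rightarrow> ('a, 'e, 'c) module_scheme \<Rightarrow> bool" where
  "injective_module _ R E \<longleftrightarrow>
     right_module R E \<and>
     (\<forall>(M :: ('a, 'm) module) N. right_module R M \<and> right_submodule R M N \<longrightarrow>
        (\<forall>f\<in>right_hom R (M\<lparr>carrier := N\<rparr>) E. \<exists>g\<in>right_hom R M E. \<forall>x\<in>N. g x = f x))"


section \<open>The regular right module and right ideals\<close>

definition right_regular :: "('a, 'b) ring_scheme \<Rightarrow> ('a, 'a) module" where
  "right_regular R =
     \<lparr>carrier = carrier R, mult = mult R, one = one R, zero = zero R, add = add R,
      smult = (\<lambda>r x. x \<otimes>\<^bsub>R\<^esub> r)\<rparr>"

abbreviation right_ideal :: "('a, 'b) ring_scheme \<Rightarrow> 'a set \<Rightarrow> bool" where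
  "right_ideal R \<equiv> right_submodule R (right_regular R)"

abbreviation right_socle :: "('a, 'b) ring_scheme \<Rightarrow> 'a set" where
  "right_socle R \<equiv> socle R (right_regular R)"

lemma right_ideal_iff:
  "right_ideal R I \<longleftrightarrow>
     additive_subgroup I R \<and> (\<forall>r\<in>carrier R. \<forall>x\<in>I. x \<otimes>\<^bsub>R\<^esub> r \<in> I)"
  by (simp add: right_submodule_def right_regular_def additive_subgroup_def subgroup_def m_inv_def)

lemma right_module_regular:
  assumes "ring R"
  shows "right_module R (right_regular R)"
proof -
  interpret ring R by (rule assms)
  have "abelian_group (right_regular R)"
    by (rule abelian_groupI)
      (auto simp: right_regular_def a_ac intro: l_neg)
  moreover have "right_module_axioms R (right_regular R)"
    by unfold_locales (simp_all add: right_regular_def l_distr r_distr m_assoc)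
  ultimately show ?thesis
    by (intro right_module.intro assms)
qed

definition maximal_right_ideal :: "('a, 'b) ring_scheme \<Rightarrow> 'a set \<Rightarrow> bool" where
  "maximal_right_ideal R M \<longleftrightarrow>
     right_ideal R M \<and> M \<noteq> carrier R \<and>
     (\<forall>K. right_ideal R K \<and> M \<subseteq> K \<longrightarrow> K = M \<or> K = carrier R)"

text \<open>
  The intersection with the carrier matters only for the zero ring, which has no maximal
  right ideals.
\<close>

definition jacobson_radical :: "('a, 'b) ring_scheme \<Rightarrow> 'a set" where
  "jacobson_radical R = carrier R \<inter> \<Inter> {M. maximal_right_ideal R M}"

definition small_right_ideal :: "('a, 'b) ring_scheme \<Rightarrow> 'a set \<Rightarrow> bool" where
  "small_right_ideal R I \<longleftrightarrow>
     right_ideal R I \<and>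
     (\<forall>K. right_ideal R K \<and> K \<noteq> carrier R \<longrightarrow> I <+>\<^bsub>R\<^esub> K \<noteq> carrier R)"


section \<open>Classes of rings\<close>

definition right_artinian :: "('a, 'b) ring_scheme \<Rightarrow> bool" where
  "right_artinian R \<longleftrightarrow>
     (\<forall>I :: nat \<Rightarrow> 'a set. (\<forall>n. right_ideal R (I n) \<and> I (Suc n) \<subseteq> I n) \<longrightarrow>
        (\<exists>n. \<forall>m\<ge>n. I m = I n))"

definition semisimple_artinian :: "('a, 'b) ring_scheme \<Rightarrow> bool" where
  "semisimple_artinian R \<longleftrightarrow> semisimple_module R (right_regular R) \<and> right_artinian R"

definition semilocal :: "('a, 'b) ring_scheme \<Rightarrow> bool" where
  "semilocal R \<longleftrightarrow> semisimple_artinian (R Quot jacobson_radical R)"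

definition semiperfect :: "('a, 'b) ring_scheme \<Rightarrow> bool" where
  "semiperfect R \<longleftrightarrow>
     semilocal R \<and>
     (\<forall>a\<in>carrier R. a \<otimes>\<^bsub>R\<^esub> a \<ominus>\<^bsub>R\<^esub> a \<in> jacobson_radical R \<longrightarrow>
        (\<exists>e\<in>carrier R. e \<otimes>\<^bsub>R\<^esub> e = e \<and> e \<ominus>\<^bsub>R\<^esub> a \<in> jacobson_radical R))"

definition right_small_injective :: "('a, 'b) ring_scheme \<Rightarrow> bool" where
  "right_small_injective R \<longleftrightarrow>
     (\<forall>I. small_right_ideal R I \<longrightarrow>
        (\<forall>f\<in>right_hom R ((right_regular R)\<lparr>carrier := I\<rparr>) (right_regular R).
           \<exists>g\<in>right_hom R (right_regular R) (right_regular R). \<forall>x\<in>I. g x = f x))"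

text \<open>
  HOL cannot quantify over types, so the test modules range over all right modules in the type
  \<^verbatim>\<open>'a + 'm\<close>.  The first summand guarantees room for a copy of R itself whatever
  \<^verbatim>\<open>'m\<close> is; the arbitrary type \<^verbatim>\<open>'m\<close> makes the universe of test modules as large as desired.
\<close>

definition right_self_injective :: "'m itself \<Rightarrow> ('a, 'b) ring_scheme \<Rightarrow> bool" where
  "right_self_injective _ R \<longleftrightarrow> injective_module TYPE('a + 'm) R (right_regular R)"

definition right_PF :: "'m itself \<Rightarrow> ('a, 'b) ring_scheme \<Rightarrow> bool" where
  "right_PF t R \<longleftrightarrow>
     semiperfect R \<and> right_self_injective t R \<and>
     essential_submodule R (right_regular R) (right_socle R)"

end

theory Submission imports Defs begin

text \<open>
  In a semilocal ring every right ideal \<open>I\<close> has a right ideal \<open>K\<close> with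
  \<open>I + K = R\<close> and \<open>I \<inter> K \<subseteq> J\<close>.  A homomorphism \<open>f: I \<rightarrow> R\<close> agrees on the small
  right ideal \<open>I \<inter> K\<close> with left multiplication by some \<open>a\<close>, so
  \<open>i + k \<mapsto> f i + a k\<close> is a well-defined extension of \<open>f\<close> to \<open>R\<close>, and \<open>R\<close> is right
  self-injective by Baer's criterion.

  In a right self-injective ring \<open>J\<close> consists of the elements whose right annihilator is
  essential.  If \<open>a\<^sup>2 - a \<in> J\<close>, then \<open>a\<close> is idempotent on the essential right ideal
  \<open>K = {x. a\<^sup>2 x = a x}\<close>, the sum \<open>a K + (1 - a) K\<close> is direct, and the idempotent \<open>e\<close>
  projecting onto a complement that contains \<open>a K\<close>, along one that contains \<open>(1 - a) K\<close>,
  agrees with \<open>a\<close> on \<open>K\<close>, so \<open>e - a \<in> J\<close>.  Hence \<open>R\<close> is semiperfect.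
\<close>

section \<open>Submodules of a right module over an arbitrary ring\<close>

context right_module
begin

lemma smult_zero_scalar:
  assumes "x \<in> carrier M"
  shows "\<zero>\<^bsub>R\<^esub> \<odot>\<^bsub>M\<^esub> x = \<zero>\<^bsub>M\<^esub>"
proof -
  have "\<zero>\<^bsub>R\<^esub> \<odot>\<^bsub>M\<^esub> x \<oplus>\<^bsub>M\<^esub> \<zero>\<^bsub>R\<^esub> \<odot>\<^bsub>M\<^esub> x = \<zero>\<^bsub>R\<^esub> \<odot>\<^bsub>M\<^esub> x"
    using smult_add_scalar[of "\<zero>\<^bsub>R\<^esub>" "\<zero>\<^bsub>R\<^esub>" x] assms by simp
  then show ?thesis
    using assms smult_closed by (metis M.add.r_cancel_one zero_closed)
qed

lemma smult_minus_one:
  assumes "x \<in> carrier M"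
  shows "(\<ominus>\<^bsub>R\<^esub> \<one>\<^bsub>R\<^esub>) \<odot>\<^bsub>M\<^esub> x = \<ominus>\<^bsub>M\<^esub> x"
proof -
  have "(\<ominus>\<^bsub>R\<^esub> \<one>\<^bsub>R\<^esub>) \<odot>\<^bsub>M\<^esub> x \<oplus>\<^bsub>M\<^esub> x = (\<ominus>\<^bsub>R\<^esub> \<one>\<^bsub>R\<^esub> \<oplus>\<^bsub>R\<^esub> \<one>\<^bsub>R\<^esub>) \<odot>\<^bsub>M\<^esub> x"
    using assms by (simp add: smult_add_scalar smult_one)
  also have "\<dots> = \<zero>\<^bsub>M\<^esub>"
    using assms by (simp add: l_neg smult_zero_scalar)
  finally show ?thesis
    using assms by (simp add: M.minus_equality smult_closed)
qed

text \<open>Closure under negation comes from closure under scalars, because the negative of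
  \<open>x\<close> is \<open>x\<close> times -1.\<close>

lemma submodule_iff:
  "right_submodule R M N \<longleftrightarrow>
     N \<subseteq> carrier M \<and> \<zero>\<^bsub>M\<^esub> \<in> N \<and> (\<forall>x\<in>N. \<forall>y\<in>N. x \<oplus>\<^bsub>M\<^esub> y \<in> N) \<and>
     (\<forall>r\<in>carrier R. \<forall>x\<in>N. r \<odot>\<^bsub>M\<^esub> x \<in> N)" (is "?L \<longleftrightarrow> ?R")
proof
  assume L: ?L
  then interpret additive_subgroup N M by (simp add: right_submodule_def)
  show ?R using L a_subset by (auto simp: right_submodule_def)
next
  assume R: ?R
  have "\<ominus>\<^bsub>M\<^esub> x \<in> N" if "x \<in> N" for x
    using R that smult_minus_one[of x] by (metis a_inv_closed one_closed subsetD)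
  then have "additive_subgroup N M"
    using R unfolding additive_subgroup_def
    by (intro M.add.subgroupI) (auto simp: a_inv_def)
  then show ?L using R by (simp add: right_submodule_def)
qed

text \<open>Zorn's lemma: any two elements of the union of a chain lie in a common member, so the
  union is again a submodule, and it still avoids \<open>C\<close>. Varying \<open>C\<close> yields
  maximal right ideals, supplements modulo the radical, complements, and maximal partial
  homomorphisms.\<close>

lemma maximal_submodule_avoiding:
  assumes A: "right_submodule R M A" and AC: "A \<inter> C = {}"
  obtains N where "right_submodule R M N" "A \<subseteq> N" "N \<inter> C = {}"
    "\<And>K. \<lbrakk>right_submodule R M K; N \<subseteq> K; K \<inter> C = {}\<rbrakk> \<Longrightarrow> K = N"
proof -
  let ?F = "{N. right_submodule R M N \<and> A \<subseteq> N \<and> N \<inter> C = {}}"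
  have "\<exists>N\<in>?F. \<forall>X\<in>?F. N \<subseteq> X \<longrightarrow> X = N"
  proof (rule subset_Zorn_nonempty)
    show "?F \<noteq> {}" using A AC by blast
  next
    fix \<C> assume ne: "\<C> \<noteq> {}" and ch: "subset.chain ?F \<C>"
    have mem: "\<And>X. X \<in> \<C> \<Longrightarrow> right_submodule R M X \<and> A \<subseteq> X \<and> X \<inter> C = {}"
      using ch by (auto simp: subset_chain_def)
    have "x \<oplus>\<^bsub>M\<^esub> y \<in> \<Union>\<C>" if "x \<in> \<Union>\<C>" "y \<in> \<Union>\<C>" for x y
    proof -
      from that obtain X Y where XY: "X \<in> \<C>" "Y \<in> \<C>" "x \<in> X" "y \<in> Y" by blast
      then have "X \<subseteq> Y \<or> Y \<subseteq> X" using ch by (auto simp: subset_chain_def)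
      then obtain Z where Z: "Z \<in> \<C>" "x \<in> Z" "y \<in> Z" using XY by blast
      then have "x \<oplus>\<^bsub>M\<^esub> y \<in> Z" using mem[of Z] submodule_iff[of Z] by blast
      then show ?thesis using Z by blast
    qed
    note add = this
    have "right_submodule R M (\<Union>\<C>)"
      unfolding submodule_iff[of "\<Union>\<C>"]
    proof (intro conjI ballI add)
      show "\<Union>\<C> \<subseteq> carrier M" using mem submodule_iff by (meson Sup_least)
      show "\<zero>\<^bsub>M\<^esub> \<in> \<Union>\<C>" using ne mem submodule_iff by (metis UnionI ex_in_conv)
      fix r x assume "r \<in> carrier R" "x \<in> \<Union>\<C>"
      then show "r \<odot>\<^bsub>M\<^esub> x \<in> \<Union>\<C>" using mem submodule_iff by (metis Union_iff)
    qed
    then show "\<Union>\<C> \<in> ?F" using ne mem by blast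
  qed
  then obtain N where N: "N \<in> ?F" "\<forall>X\<in>?F. N \<subseteq> X \<longrightarrow> X = N" by (rule bexE)
  show ?thesis
  proof (rule that[of N])
    show "right_submodule R M N" "A \<subseteq> N" "N \<inter> C = {}" using N(1) by simp_all
    fix K assume K: "right_submodule R M K" "N \<subseteq> K" "K \<inter> C = {}"
    have "A \<subseteq> K" using N(1) K(2) by blast
    then show "K = N" using N(2)[rule_format, of K] K by simp
  qed
qed

lemma mem_set_add:
  "x \<in> A <+>\<^bsub>M\<^esub> B \<longleftrightarrow> (\<exists>a\<in>A. \<exists>b\<in>B. x = a \<oplus>\<^bsub>M\<^esub> b)"
  by (auto simp: set_add_def set_mult_def)

lemma submodule_set_add:
  assumes A: "right_submodule R M A" and B: "right_submodule R M B"
  shows "right_submodule R M (A <+>\<^bsub>M\<^esub> B)"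
proof -
  note A' = A[unfolded submodule_iff] and B' = B[unfolded submodule_iff]
  have add: "x \<oplus>\<^bsub>M\<^esub> y \<in> A <+>\<^bsub>M\<^esub> B" if xy: "x \<in> A <+>\<^bsub>M\<^esub> B" "y \<in> A <+>\<^bsub>M\<^esub> B" for x y
  proof -
    from xy obtain a b a' b' where *: "a \<in> A" "b \<in> B" "x = a \<oplus>\<^bsub>M\<^esub> b" "a' \<in> A" "b' \<in> B" "y = a' \<oplus>\<^bsub>M\<^esub> b'"
      by (auto simp: mem_set_add)
    then have "a \<in> carrier M" "b \<in> carrier M" "a' \<in> carrier M" "b' \<in> carrier M"
      using A' B' by auto
    then have "x \<oplus>\<^bsub>M\<^esub> y = (a \<oplus>\<^bsub>M\<^esub> a') \<oplus>\<^bsub>M\<^esub> (b \<oplus>\<^bsub>M\<^esub> b')"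
      using * by (simp add: M.a_ac)
    moreover have "a \<oplus>\<^bsub>M\<^esub> a' \<in> A" "b \<oplus>\<^bsub>M\<^esub> b' \<in> B" using * A' B' by blast+
    ultimately show ?thesis unfolding mem_set_add by blast
  qed
  have smult: "r \<odot>\<^bsub>M\<^esub> x \<in> A <+>\<^bsub>M\<^esub> B" if r: "r \<in> carrier R" and x: "x \<in> A <+>\<^bsub>M\<^esub> B" for r x
  proof -
    from x obtain a b where *: "a \<in> A" "b \<in> B" "x = a \<oplus>\<^bsub>M\<^esub> b" by (auto simp: mem_set_add)
    then have "a \<in> carrier M" "b \<in> carrier M" using A' B' by auto
    then have "r \<odot>\<^bsub>M\<^esub> x = r \<odot>\<^bsub>M\<^esub> a \<oplus>\<^bsub>M\<^esub> r \<odot>\<^bsub>M\<^esub> b" using * r by (simp add: smult_add)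
    moreover have "r \<odot>\<^bsub>M\<^esub> a \<in> A" "r \<odot>\<^bsub>M\<^esub> b \<in> B" using * r A' B' by blast+
    ultimately show ?thesis unfolding mem_set_add by blast
  qed
  have sub: "A <+>\<^bsub>M\<^esub> B \<subseteq> carrier M"
  proof
    fix x assume "x \<in> A <+>\<^bsub>M\<^esub> B"
    then obtain a b where "a \<in> A" "b \<in> B" "x = a \<oplus>\<^bsub>M\<^esub> b" by (auto simp: mem_set_add)
    moreover from this have "a \<in> carrier M" "b \<in> carrier M" using A' B' by blast+
    ultimately show "x \<in> carrier M" by simp
  qed
  have zero: "\<zero>\<^bsub>M\<^esub> \<in> A <+>\<^bsub>M\<^esub> B" unfolding mem_set_add using A' B' by (metis M.r_zero M.zero_closed)
  show ?thesis unfolding submodule_iff[of "A <+>\<^bsub>M\<^esub> B"] using sub zero add smult by blast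
qed

lemma subset_set_add:
  assumes A: "right_submodule R M A" and B: "right_submodule R M B"
  shows "A \<subseteq> A <+>\<^bsub>M\<^esub> B" "B \<subseteq> A <+>\<^bsub>M\<^esub> B"
  using A B unfolding submodule_iff mem_set_add subset_eq
  by (metis M.r_zero, metis M.l_zero)

lemma cyclic_submodule:
  assumes x: "x \<in> carrier M"
  shows "right_submodule R M ((\<lambda>r. r \<odot>\<^bsub>M\<^esub> x) ` carrier R)"
  unfolding submodule_iff
proof (intro conjI ballI)
  show "(\<lambda>r. r \<odot>\<^bsub>M\<^esub> x) ` carrier R \<subseteq> carrier M" using x smult_closed by auto
  show "\<zero>\<^bsub>M\<^esub> \<in> (\<lambda>r. r \<odot>\<^bsub>M\<^esub> x) ` carrier R"
    using x smult_zero_scalar by (metis zero_closed image_eqI)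
next
  fix y z assume "y \<in> (\<lambda>r. r \<odot>\<^bsub>M\<^esub> x) ` carrier R" "z \<in> (\<lambda>r. r \<odot>\<^bsub>M\<^esub> x) ` carrier R"
  then show "y \<oplus>\<^bsub>M\<^esub> z \<in> (\<lambda>r. r \<odot>\<^bsub>M\<^esub> x) ` carrier R"
    using x by (auto simp flip: smult_add_scalar)
next
  fix r y assume "r \<in> carrier R" "y \<in> (\<lambda>r. r \<odot>\<^bsub>M\<^esub> x) ` carrier R"
  then show "r \<odot>\<^bsub>M\<^esub> y \<in> (\<lambda>r. r \<odot>\<^bsub>M\<^esub> x) ` carrier R"
    using x by (auto simp flip: smult_mult)
qed

lemma mem_cyclic:
  assumes "x \<in> carrier M"
  shows "x \<in> (\<lambda>r. r \<odot>\<^bsub>M\<^esub> x) ` carrier R"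
  using assms smult_one by (metis one_closed image_eqI)

end

section \<open>Right ideals as submodules of the regular module\<close>

lemma right_regular_simps [simp]:
  "carrier (right_regular R) = carrier R"
  "add (right_regular R) = add R"
  "zero (right_regular R) = zero R"
  "r \<odot>\<^bsub>right_regular R\<^esub> x = x \<otimes>\<^bsub>R\<^esub> r"
  "set_add (right_regular R) = set_add R"
  by (auto simp: right_regular_def set_add_def set_mult_def fun_eq_iff)

text \<open>An endomorphism of the regular right module is left multiplication by the image of 1.
  Extendability from \<open>I\<close> to the whole ring is therefore recorded by a single ring
  element \<open>c\<close>.\<close>

definition extends_by_left_mult :: "('a, 'b) ring_scheme \<Rightarrow> 'a set \<Rightarrow> bool" where
  "extends_by_left_mult R I \<longleftrightarrow>
     (\<forall>f\<in>right_hom R ((right_regular R)\<lparr>carrier := I\<rparr>) (right_regular R).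
        \<exists>c\<in>carrier R. \<forall>x\<in>I. f x = c \<otimes>\<^bsub>R\<^esub> x)"

lemma right_hom_ideal_iff:
  "f \<in> right_hom R ((right_regular R)\<lparr>carrier := I\<rparr>) (right_regular R) \<longleftrightarrow>
     f \<in> I \<rightarrow> carrier R \<and> (\<forall>x\<in>I. \<forall>y\<in>I. f (x \<oplus>\<^bsub>R\<^esub> y) = f x \<oplus>\<^bsub>R\<^esub> f y) \<and>
     (\<forall>x\<in>I. \<forall>r\<in>carrier R. f (x \<otimes>\<^bsub>R\<^esub> r) = f x \<otimes>\<^bsub>R\<^esub> r)"
  by (auto simp: right_hom_def right_regular_def)

context ring
begin

sublocale regular: right_module R "right_regular R"
  by (rule right_module_regular) (rule ring_axioms)

lemmas right_ideal_char = regular.submodule_iff[simplified]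
lemmas maximal_right_ideal_avoiding = regular.maximal_submodule_avoiding[simplified]
lemmas mem_ideal_sum = regular.mem_set_add[simplified]
lemmas right_ideal_sum = regular.submodule_set_add[simplified]
lemmas subset_ideal_sum = regular.subset_set_add[simplified]
lemmas right_ideal_cyclic = regular.cyclic_submodule[simplified]
lemmas mem_right_cyclic = regular.mem_cyclic[simplified]

lemma right_ideal_closed:
  assumes "right_ideal R I"
  shows "x \<in> I \<Longrightarrow> x \<in> carrier R"
    and "\<zero> \<in> I"
    and "\<lbrakk>x \<in> I; y \<in> I\<rbrakk> \<Longrightarrow> x \<oplus> y \<in> I"
    and "\<lbrakk>x \<in> I; r \<in> carrier R\<rbrakk> \<Longrightarrow> x \<otimes> r \<in> I"
  using assms by (auto simp: right_ideal_char)

lemma right_ideal_minus: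
  assumes "right_ideal R I" "x \<in> I"
  shows "\<ominus> x \<in> I"
proof -
  have "x \<in> carrier R" "x \<otimes> (\<ominus> \<one>) \<in> I"
    using assms by (auto simp: right_ideal_char)
  then show ?thesis by (simp add: r_minus)
qed

lemma right_ideal_diff:
  assumes "right_ideal R I" "x \<in> I" "y \<in> I"
  shows "x \<ominus> y \<in> I"
  using assms right_ideal_minus[of I y] by (simp add: minus_eq right_ideal_char)

lemma right_ideal_eq_carrier:
  assumes "right_ideal R I" "\<one> \<in> I"
  shows "I = carrier R"
  using assms unfolding right_ideal_char by (metis l_one subset_antisym subsetI)

lemma extends_by_left_mult_iff:
  "extends_by_left_mult R I \<longleftrightarrow>
     (\<forall>f\<in>right_hom R ((right_regular R)\<lparr>carrier := I\<rparr>) (right_regular R).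
        \<exists>g\<in>right_hom R (right_regular R) (right_regular R). \<forall>x\<in>I. g x = f x)"
  if I: "I \<subseteq> carrier R"
proof -
  have 1: "(\<lambda>x. c \<otimes> x) \<in> right_hom R (right_regular R) (right_regular R)" if "c \<in> carrier R" for c
    using that by (auto simp: right_hom_def r_distr m_assoc)
  have 2: "g \<one> \<in> carrier R \<and> (\<forall>x\<in>I. g x = g \<one> \<otimes> x)"
    if g: "g \<in> right_hom R (right_regular R) (right_regular R)" for g
  proof -
    have "\<forall>r\<in>carrier R. \<forall>x\<in>carrier R. g (x \<otimes> r) = g x \<otimes> r" "g \<in> carrier R \<rightarrow> carrier R"
      using g by (simp_all add: right_hom_def)
    then show ?thesis using I by (metis PiE l_one one_closed subsetD)
  qed
  show ?thesis
    unfolding extends_by_left_mult_def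
  proof (intro ball_cong refl iffI)
    fix f assume "\<exists>c\<in>carrier R. \<forall>x\<in>I. f x = c \<otimes> x"
    then show "\<exists>g\<in>right_hom R (right_regular R) (right_regular R). \<forall>x\<in>I. g x = f x"
      using 1 by metis
  next
    fix f assume "\<exists>g\<in>right_hom R (right_regular R) (right_regular R). \<forall>x\<in>I. g x = f x"
    then show "\<exists>c\<in>carrier R. \<forall>x\<in>I. f x = c \<otimes> x"
      using 2 by metis
  qed
qed

lemma right_small_injective_iff:
  "right_small_injective R \<longleftrightarrow> (\<forall>I. small_right_ideal R I \<longrightarrow> extends_by_left_mult R I)"
  unfolding right_small_injective_def
  using extends_by_left_mult_iff by (auto simp: small_right_ideal_def right_ideal_char)

section \<open>Maximal right ideals and the Jacobson radical\<close>

text \<open>A right ideal is proper exactly when it avoids 1, so a right ideal maximal among those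
  that avoid 1 is a maximal right ideal.\<close>

lemma proper_right_ideal_in_maximal:
  assumes "right_ideal R I" "I \<noteq> carrier R"
  obtains N where "maximal_right_ideal R N" "I \<subseteq> N"
proof -
  have "I \<inter> {\<one>} = {}" using assms right_ideal_eq_carrier by blast
  from maximal_right_ideal_avoiding[OF assms(1) this] obtain N where
    N: "right_ideal R N" "I \<subseteq> N" "N \<inter> {\<one>} = {}"
      "\<And>K. \<lbrakk>right_ideal R K; N \<subseteq> K; K \<inter> {\<one>} = {}\<rbrakk> \<Longrightarrow> K = N" by blast
  have "maximal_right_ideal R N"
    unfolding maximal_right_ideal_def using N right_ideal_eq_carrier by auto
  then show ?thesis using that N by blast
qed

lemma maximal_right_idealD:
  assumes "maximal_right_ideal R N"
  shows "right_ideal R N" "\<one> \<notin> N"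
  using assms right_ideal_eq_carrier by (auto simp: maximal_right_ideal_def)

lemma right_ideal_jacobson: "right_ideal R (jacobson_radical R)"
  using maximal_right_idealD(1)
  unfolding right_ideal_char jacobson_radical_def by auto

text \<open>A proper \<open>K\<close> lies in a maximal right ideal \<open>N\<close>, which contains
  the radical and hence \<open>I\<close>; so \<open>I + K\<close> stays inside
  \<open>N\<close>.\<close>

lemma small_if_subset_jacobson:
  assumes I: "right_ideal R I" "I \<subseteq> jacobson_radical R"
  shows "small_right_ideal R I"
  unfolding small_right_ideal_def
proof (intro conjI allI impI)
  fix K assume K: "right_ideal R K \<and> K \<noteq> carrier R"
  then obtain N where N: "maximal_right_ideal R N" "K \<subseteq> N"
    using proper_right_ideal_in_maximal by blast
  have "I \<subseteq> N" using I N by (auto simp: jacobson_radical_def)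
  then have "I <+> K \<subseteq> N"
    using N right_ideal_closed(3)[OF maximal_right_idealD(1)[OF N(1)]]
    by (auto simp: mem_ideal_sum subset_iff)
  then show "I <+> K \<noteq> carrier R" using maximal_right_idealD(2)[OF N(1)] by auto
qed (rule I(1))

text \<open>If 1 - ar has no right inverse, the right ideal it generates lies in a maximal
  \<open>N\<close>; as \<open>N\<close> also contains ar, it contains 1. Conversely, if a maximal
  \<open>N\<close> misses \<open>a\<close>, then N + aR = R, so 1 = n + ar, and n = 1 - ar is a
  right invertible element of \<open>N\<close>.\<close>

lemma jacobson_iff_right_inverse:
  "a \<in> jacobson_radical R \<longleftrightarrow>
     a \<in> carrier R \<and> (\<forall>r\<in>carrier R. \<exists>s\<in>carrier R. (\<one> \<ominus> a \<otimes> r) \<otimes> s = \<one>)" (is "?L \<longleftrightarrow> ?R")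
proof
  assume a: ?L
  then have aR: "a \<in> carrier R" by (simp add: jacobson_radical_def)
  have "\<exists>s\<in>carrier R. (\<one> \<ominus> a \<otimes> r) \<otimes> s = \<one>" if r: "r \<in> carrier R" for r
  proof (rule ccontr)
    assume n: "\<not> ?thesis"
    let ?x = "\<one> \<ominus> a \<otimes> r" and ?I = "(\<lambda>s. (\<one> \<ominus> a \<otimes> r) \<otimes> s) ` carrier R"
    have x: "?x \<in> carrier R" using aR r by simp
    have "\<one> \<notin> ?I" using n by force
    then have "?I \<noteq> carrier R" by auto
    then obtain N where N: "maximal_right_ideal R N" "?I \<subseteq> N"
      using proper_right_ideal_in_maximal right_ideal_cyclic[OF x] by blast
    note N' = maximal_right_idealD[OF N(1)]
    have "?x \<in> N" using N mem_right_cyclic[OF x] by blast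
    moreover have "a \<otimes> r \<in> N"
      using a N N'(1) r unfolding right_ideal_char by (auto simp: jacobson_radical_def)
    ultimately have "?x \<oplus> a \<otimes> r \<in> N" using N'(1) by (auto simp: right_ideal_char)
    moreover have "?x \<oplus> a \<otimes> r = \<one>" using aR r by (simp add: minus_eq a_assoc l_neg)
    ultimately show False using N'(2) by simp
  qed
  then show ?R using aR by blast
next
  assume R: ?R
  have "a \<in> N" if N: "maximal_right_ideal R N" for N
  proof (rule ccontr)
    assume aN: "a \<notin> N"
    let ?aR = "(\<lambda>s. a \<otimes> s) ` carrier R"
    note N' = maximal_right_idealD[OF N]
    have c: "right_ideal R ?aR" using R right_ideal_cyclic by blast
    have "a \<in> ?aR" using R mem_right_cyclic by blast
    then have "a \<in> N <+> ?aR" using subset_ideal_sum(2)[OF N'(1) c] by blast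
    then have "N <+> ?aR = carrier R"
      using N aN right_ideal_sum[OF N'(1) c] subset_ideal_sum(1)[OF N'(1) c]
      unfolding maximal_right_ideal_def by blast
    then have "\<one> \<in> N <+> ?aR" by simp
    then obtain n r where nr: "n \<in> N" "r \<in> carrier R" "\<one> = n \<oplus> a \<otimes> r"
      unfolding mem_ideal_sum by blast
    moreover have nR: "n \<in> carrier R" using nr(1) N'(1) by (auto simp: right_ideal_char)
    ultimately have "\<one> \<ominus> a \<otimes> r = n" using R by (simp add: minus_eq a_assoc r_neg)
    then obtain s where "s \<in> carrier R" "n \<otimes> s = \<one>" using R nr(2) by blast
    then have "\<one> \<in> N" using nr(1) N'(1) unfolding right_ideal_char by metis
    then show False using N'(2) by simp
  qed
  then show ?L using R by (simp add: jacobson_radical_def)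
qed

text \<open>A right inverse \<open>s\<close> of 1 - a satisfies s = 1 - a(-s), so it has a right
  inverse \<open>t\<close> by the same criterion. Then \<open>s\<close> has 1 - a on its left and
  \<open>t\<close> on its right as inverses, whence t = 1 - a.\<close>

lemma one_minus_jacobson_Units:
  assumes a: "a \<in> jacobson_radical R"
  shows "\<one> \<ominus> a \<in> Units R"
proof -
  have aR: "a \<in> carrier R" using a by (simp add: jacobson_radical_def)
  obtain s where s: "s \<in> carrier R" "(\<one> \<ominus> a) \<otimes> s = \<one>"
    using a aR jacobson_iff_right_inverse[of a] by (metis one_closed r_one)
  have "s \<ominus> a \<otimes> s = \<one>" using s aR by (simp add: minus_eq l_distr l_minus)
  then have "s = \<one> \<ominus> a \<otimes> (\<ominus> s)"
    using s aR by (simp add: minus_eq r_minus) (metis a_assoc a_inv_closed l_neg m_closed r_zero)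
  then obtain t where t: "t \<in> carrier R" "s \<otimes> t = \<one>"
    using a s jacobson_iff_right_inverse[of a] by (metis a_inv_closed)
  have "t = (\<one> \<ominus> a) \<otimes> s \<otimes> t" using s t by simp
  also have "\<dots> = \<one> \<ominus> a" using s(1) t aR by (simp only: m_assoc minus_closed one_closed r_one)
  finally have "s \<otimes> (\<one> \<ominus> a) = \<one>" using t by simp
  then show ?thesis using s aR by (auto simp: Units_def)
qed

text \<open>The witness comes from the formal geometric series: 1 + ba + baba + ... = 1 + b(1 + ab +
  ...)a, with \<open>u\<close> in place of the inner series.\<close>

lemma one_minus_mult_commute_right_inverse:
  assumes c: "a \<in> carrier R" "b \<in> carrier R" "u \<in> carrier R"
    and u: "(\<one> \<ominus> a \<otimes> b) \<otimes> u = \<one>"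
  shows "(\<one> \<ominus> b \<otimes> a) \<otimes> (\<one> \<oplus> b \<otimes> u \<otimes> a) = \<one>"
proof -
  have "u \<ominus> a \<otimes> b \<otimes> u = \<one>" using u c by (simp add: minus_eq l_distr l_minus)
  then have *: "b \<otimes> (u \<ominus> a \<otimes> b \<otimes> u) \<otimes> a = b \<otimes> a" using c by simp
  have "(\<one> \<ominus> b \<otimes> a) \<otimes> (\<one> \<oplus> b \<otimes> u \<otimes> a) = \<one> \<ominus> b \<otimes> a \<oplus> b \<otimes> (u \<ominus> a \<otimes> b \<otimes> u) \<otimes> a"
    using c by (simp add: minus_eq l_distr r_distr l_minus r_minus m_assoc a_ac)
  also have "\<dots> = \<one>" unfolding * using c by (simp add: minus_eq a_assoc l_neg)
  finally show ?thesis .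
qed

text \<open>The radical is defined by right ideals, so only closure under multiplication from the
  right is immediate. For the left side, arb lies in the radical, and the right inverse of 1 - (ar)b
  is converted into one of 1 - b(ar).\<close>

lemma jacobson_mult_left:
  assumes a: "a \<in> jacobson_radical R" and b: "b \<in> carrier R"
  shows "b \<otimes> a \<in> jacobson_radical R"
proof -
  have aR: "a \<in> carrier R" using a by (simp add: jacobson_radical_def)
  have "\<exists>s\<in>carrier R. (\<one> \<ominus> b \<otimes> a \<otimes> r) \<otimes> s = \<one>" if r: "r \<in> carrier R" for r
  proof -
    have "a \<otimes> r \<otimes> b \<in> jacobson_radical R"
      using a b r right_ideal_jacobson by (auto simp: right_ideal_char)
    then obtain u where u: "u \<in> carrier R" "(\<one> \<ominus> (a \<otimes> r) \<otimes> b) \<otimes> u = \<one>"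
      using jacobson_iff_right_inverse[of "a \<otimes> r \<otimes> b"] by (metis aR b m_closed one_closed r r_one)
    then have "(\<one> \<ominus> b \<otimes> (a \<otimes> r)) \<otimes> (\<one> \<oplus> b \<otimes> u \<otimes> (a \<otimes> r)) = \<one>"
      using aR b r by (intro one_minus_mult_commute_right_inverse) auto
    moreover have "b \<otimes> (a \<otimes> r) = b \<otimes> a \<otimes> r" using aR b r by (simp add: m_assoc)
    ultimately show ?thesis using aR b r u
      by (metis a_closed m_closed one_closed)
  qed
  then show ?thesis using jacobson_iff_right_inverse aR b by simp
qed

lemma ideal_jacobson: "ideal (jacobson_radical R) R"
proof (rule idealI)
  show "subgroup (jacobson_radical R) (add_monoid R)"
    using right_ideal_jacobson by (simp add: right_ideal_iff additive_subgroup_def)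
next
  fix a x assume "a \<in> jacobson_radical R" "x \<in> carrier R"
  then show "x \<otimes> a \<in> jacobson_radical R" "a \<otimes> x \<in> jacobson_radical R"
    using jacobson_mult_left right_ideal_jacobson by (auto simp: right_ideal_char)
qed (rule ring_axioms)

end

section \<open>Right ideals along a surjective ring homomorphism\<close>

lemma (in ring_hom_ring) right_ideal_image:
  assumes surj: "h ` carrier R = carrier S" and I: "right_ideal R I"
  shows "right_ideal S (h ` I)"
  unfolding S.right_ideal_char
proof (intro conjI ballI)
  note c = R.right_ideal_closed[OF I]
  show "h ` I \<subseteq> carrier S" using c(1) by auto
  show "\<zero>\<^bsub>S\<^esub> \<in> h ` I" using c(2) by (metis hom_zero imageI)
  fix x assume "x \<in> h ` I"
  then obtain a where a: "a \<in> I" "x = h a" by blast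
  {
    fix y assume "y \<in> h ` I"
    then obtain b where "b \<in> I" "y = h b" by blast
    then have "x \<oplus>\<^bsub>S\<^esub> y = h (a \<oplus> b)" "a \<oplus> b \<in> I" using a c by auto
    then show "x \<oplus>\<^bsub>S\<^esub> y \<in> h ` I" by blast
  }
  fix s assume "s \<in> carrier S"
  then obtain r where "r \<in> carrier R" "s = h r" using surj by blast
  then have "x \<otimes>\<^bsub>S\<^esub> s = h (a \<otimes> r)" "a \<otimes> r \<in> I" using a c by auto
  then show "x \<otimes>\<^bsub>S\<^esub> s \<in> h ` I" by blast
qed

lemma (in ring_hom_ring) right_ideal_preimage:
  assumes I: "right_ideal S I"
  shows "right_ideal R {x \<in> carrier R. h x \<in> I}"
  unfolding R.right_ideal_char
proof (intro conjI ballI)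
  note c = S.right_ideal_closed[OF I]
  show "{x \<in> carrier R. h x \<in> I} \<subseteq> carrier R" "\<zero> \<in> {x \<in> carrier R. h x \<in> I}"
    using c(2) by simp_all
  fix x assume x: "x \<in> {x \<in> carrier R. h x \<in> I}"
  show "x \<oplus> y \<in> {x \<in> carrier R. h x \<in> I}" if "y \<in> {x \<in> carrier R. h x \<in> I}" for y
    using x that c(3)[of "h x" "h y"] by simp
  show "x \<otimes> r \<in> {x \<in> carrier R. h x \<in> I}" if "r \<in> carrier R" for r
    using x that c(4)[of "h x" "h r"] by simp
qed

text \<open>The image of \<open>L\<close> is a proper right ideal of \<open>S\<close>, so it cannot
  contain the socle, which is all of \<open>S\<close>; some simple \<open>U\<close> is therefore not
  inside it. The preimage of \<open>U\<close> is \<open>T\<close>, and simplicity of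
  \<open>U\<close> makes \<open>T\<close> minimal over the kernel. With \<open>S\<close> = R/J this
  provides what semilocality is used for.\<close>

lemma (in ring_hom_ring) simple_preimage_not_in:
  assumes surj: "h ` carrier R = carrier S"
    and ss: "semisimple_module S (right_regular S)"
    and L: "right_ideal R L" "a_kernel R S h \<subseteq> L" "L \<noteq> carrier R"
  obtains T where "right_ideal R T" "a_kernel R S h \<subseteq> T" "\<not> T \<subseteq> L"
    "\<And>N. \<lbrakk>right_ideal R N; a_kernel R S h \<subseteq> N; N \<subseteq> T\<rbrakk> \<Longrightarrow> N = a_kernel R S h \<or> N = T"
proof -
  have ker: "a_kernel R S h = {x \<in> carrier R. h x = \<zero>\<^bsub>S\<^esub>}"
    unfolding a_kernel_def' ..
  \<comment> \<open>A right ideal that contains the kernel is a union of fibres of \<open>h\<close>,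
    so membership can be tested on images.\<close>
  have sat: "x \<in> N" if N: "right_ideal R N" "a_kernel R S h \<subseteq> N" and x: "x \<in> carrier R" "h x \<in> h ` N" for N x
  proof -
    obtain y where y: "y \<in> N" "h x = h y" using x(2) by blast
    have yR: "y \<in> carrier R" using R.right_ideal_closed(1)[OF N(1) y(1)] .
    have "h (x \<ominus> y) = \<zero>\<^bsub>S\<^esub>" using x(1) y yR by (simp add: R.minus_eq S.r_neg)
    then have "x \<ominus> y \<in> N" using N(2) x(1) yR unfolding ker by auto
    then have "x \<ominus> y \<oplus> y \<in> N" using R.right_ideal_closed(3)[OF N(1)] y(1) by blast
    then show ?thesis using x(1) yR by (simp add: R.minus_eq R.a_assoc R.l_neg)
  qed
  have hL: "right_ideal S (h ` L)" using right_ideal_image[OF surj L(1)] .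
  have "\<not> carrier S \<subseteq> h ` L"
  proof
    assume "carrier S \<subseteq> h ` L"
    then have "carrier R \<subseteq> L" using sat[OF L(1,2)] hom_closed by blast
    then show False using L(3) R.right_ideal_closed(1)[OF L(1)] by blast
  qed
  then have "\<not> socle S (right_regular S) \<subseteq> h ` L"
    using ss by (simp add: semisimple_module_def)
  then obtain U where U: "simple_submodule S (right_regular S) U" "\<not> U \<subseteq> h ` L"
    using hL unfolding socle_def by blast
  have Ui: "right_ideal S U"
    and Us: "\<And>N. \<lbrakk>right_ideal S N; N \<subseteq> U\<rbrakk> \<Longrightarrow> N = {\<zero>\<^bsub>S\<^esub>} \<or> N = U"
    using U(1) by (simp_all add: simple_submodule_def)
  let ?T = "{x \<in> carrier R. h x \<in> U}"
  show ?thesis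
  proof (rule that[of ?T])
    show "right_ideal R ?T" using right_ideal_preimage[OF Ui] .
    show "a_kernel R S h \<subseteq> ?T" using S.right_ideal_closed(2)[OF Ui] by (auto simp: ker)
    obtain u where u: "u \<in> U" "u \<notin> h ` L" using U(2) by blast
    then have "u \<in> carrier S" using S.right_ideal_closed(1)[OF Ui] by blast
    then obtain x where "x \<in> carrier R" "u = h x" using surj by blast
    then show "\<not> ?T \<subseteq> L" using u by blast
  next
    fix N assume N: "right_ideal R N" "a_kernel R S h \<subseteq> N" "N \<subseteq> ?T"
    have NR: "N \<subseteq> carrier R" using N(3) by blast
    have "h ` N = {\<zero>\<^bsub>S\<^esub>} \<or> h ` N = U"
      using N(3) by (intro Us right_ideal_image[OF surj N(1)]) auto
    then show "N = a_kernel R S h \<or> N = ?T"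
    proof
      assume "h ` N = {\<zero>\<^bsub>S\<^esub>}"
      then have "N \<subseteq> a_kernel R S h" using NR unfolding ker by blast
      then show ?thesis using N(2) by blast
    next
      assume "h ` N = U"
      then have "?T \<subseteq> N" using sat[OF N(1,2)] by blast
      then show ?thesis using N(3) by blast
    qed
  qed
qed

lemma (in ideal) a_kernel_rcos: "a_kernel R (R Quot I) ((+>) I) = I"
proof -
  have "I +> x = I \<longleftrightarrow> x \<in> I" if "x \<in> carrier R" for x
    using that a_rcos_self[of x] a_rcos_const[of x] by auto
  then show ?thesis using a_subset by (auto simp: a_kernel_def' FactRing_def)
qed

lemma (in ideal) rcos_surj: "(+>) I ` carrier R = carrier (R Quot I)"
  by (auto simp: FactRing_def A_RCOSETS_def')

section \<open>Weak supplements and extension of homomorphisms in semilocal rings\<close>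

context ring
begin

text \<open>\<open>K\<close> is maximal among the right ideals that contain J and meet I + J only in
  J, that is, a complement of the image of \<open>I\<close> in R/J. If I + K were proper, some
  \<open>T\<close> minimal over J would not lie in it, so T and I + K would meet exactly in J; then
  K + T would contradict the maximality of \<open>K\<close>.\<close>

lemma semilocal_weak_supplement:
  assumes sl: "semilocal R" and I: "right_ideal R I"
  obtains K where "right_ideal R K" "I <+>\<^bsub>R\<^esub> K = carrier R" "I \<inter> K \<subseteq> jacobson_radical R"
proof -
  let ?J = "jacobson_radical R"
  interpret J: ideal ?J R by (rule ideal_jacobson)
  interpret q: ring_hom_ring R "R Quot ?J" "(+>) ?J" by (rule J.rcos_ring_hom_ring)
  note Jr = right_ideal_jacobson
  have "semisimple_module (R Quot ?J) (right_regular (R Quot ?J))"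
    using sl by (simp add: semilocal_def semisimple_artinian_def)
  note simple = q.simple_preimage_not_in[OF J.rcos_surj this, unfolded J.a_kernel_rcos]
  let ?C = "(I <+>\<^bsub>R\<^esub> ?J) - ?J"
  have "?J \<inter> ?C = {}" by blast
  from maximal_right_ideal_avoiding[OF Jr this] obtain K where
    K: "right_ideal R K" "?J \<subseteq> K" "K \<inter> ?C = {}"
      "\<And>K'. \<lbrakk>right_ideal R K'; K \<subseteq> K'; K' \<inter> ?C = {}\<rbrakk> \<Longrightarrow> K' = K" by blast
  let ?L = "I <+>\<^bsub>R\<^esub> K"
  have L: "right_ideal R ?L" using right_ideal_sum[OF I K(1)] .
  note IL = subset_ideal_sum[OF I K(1)]
  have "?L = carrier R"
  proof (rule ccontr)
    assume "?L \<noteq> carrier R"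
    moreover have "?J \<subseteq> ?L" using K(2) IL by blast
    ultimately obtain T where T: "right_ideal R T" "?J \<subseteq> T" "\<not> T \<subseteq> ?L"
      "\<And>N. \<lbrakk>right_ideal R N; ?J \<subseteq> N; N \<subseteq> T\<rbrakk> \<Longrightarrow> N = ?J \<or> N = T"
      using simple[OF L] by blast
    have "right_ideal R (T \<inter> ?L)"
      using T(1) L unfolding right_ideal_char by blast
    then have TL: "T \<inter> ?L = ?J" using T \<open>?J \<subseteq> ?L\<close> by blast
    \<comment> \<open>If k + t = i + j lies in I + J, then t = i + j - k lies in both
      \<open>T\<close> and I + K, hence in J and in \<open>K\<close>. So k + t is an element of
      \<open>K\<close> in I + J, and it lies in J by the choice of \<open>K\<close>.\<close>
    have "(K <+>\<^bsub>R\<^esub> T) \<inter> ?C = {}"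
    proof (rule ccontr)
      assume "(K <+>\<^bsub>R\<^esub> T) \<inter> ?C \<noteq> {}"
      then obtain k t i j where *: "k \<in> K" "t \<in> T" "i \<in> I" "j \<in> ?J" "k \<oplus> t = i \<oplus> j" "k \<oplus> t \<notin> ?J"
        by (auto simp: mem_ideal_sum)
      note closed = right_ideal_closed
      have cs: "k \<in> carrier R" "t \<in> carrier R" "i \<in> carrier R" "j \<in> carrier R"
        using * closed(1)[OF K(1)] closed(1)[OF T(1)] closed(1)[OF I] closed(1)[OF Jr] by blast+
      have "t = i \<oplus> j \<ominus> k"
        unfolding *(5)[symmetric] a_comm[OF cs(1,2)] using cs by (simp add: minus_eq a_assoc r_neg)
      moreover have "i \<oplus> j \<ominus> k \<in> ?L"
        using * \<open>?J \<subseteq> ?L\<close> IL by (intro right_ideal_diff[OF L] closed(3)[OF L]) auto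
      ultimately have "t \<in> ?J" using *(2) TL by blast
      then have "k \<oplus> t \<in> K" using * K(2) closed(3)[OF K(1)] by blast
      moreover have "k \<oplus> t \<in> I <+>\<^bsub>R\<^esub> ?J" using * by (auto simp: mem_ideal_sum)
      ultimately show False using *(6) K(3) by blast
    qed
    then have "K <+>\<^bsub>R\<^esub> T = K"
      using K(4) right_ideal_sum[OF K(1) T(1)] subset_ideal_sum(1)[OF K(1) T(1)] by blast
    then have "T \<subseteq> ?L" using subset_ideal_sum(2)[OF K(1) T(1)] IL by blast
    then show False using T(3) by blast
  qed
  moreover have "I \<inter> K \<subseteq> ?J"
    using K(3) subset_ideal_sum(1)[OF I Jr] by blast
  ultimately show ?thesis using that K(1) by blast
qed

lemma semilocal_small_injective_extends:
  assumes sl: "semilocal R" and si: "right_small_injective R" and I: "right_ideal R I"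
  shows "extends_by_left_mult R I"
  unfolding extends_by_left_mult_def
proof
  fix f assume f: "f \<in> right_hom R ((right_regular R)\<lparr>carrier := I\<rparr>) (right_regular R)"
  note f' = f[unfolded right_hom_ideal_iff]
  have fR: "f x \<in> carrier R" if "x \<in> I" for x using f' that by blast
  note closed = right_ideal_closed[OF I]
  obtain K where K: "right_ideal R K" "I <+>\<^bsub>R\<^esub> K = carrier R" "I \<inter> K \<subseteq> jacobson_radical R"
    using semilocal_weak_supplement[OF sl I] .
  have IK: "right_ideal R (I \<inter> K)" using I K(1) unfolding right_ideal_char by blast
  then have "extends_by_left_mult R (I \<inter> K)"
    using si small_if_subset_jacobson[OF IK K(3)] by (simp add: right_small_injective_iff)
  moreover have "f \<in> right_hom R ((right_regular R)\<lparr>carrier := I \<inter> K\<rparr>) (right_regular R)"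
    using f' unfolding right_hom_ideal_iff by blast
  ultimately obtain a where a: "a \<in> carrier R" "\<And>x. x \<in> I \<inter> K \<Longrightarrow> f x = a \<otimes> x"
    unfolding extends_by_left_mult_def by blast
  have "\<one> \<in> I <+>\<^bsub>R\<^esub> K" using K(2) by simp
  then obtain i k where ik: "i \<in> I" "k \<in> K" "\<one> = i \<oplus> k" by (auto simp: mem_ideal_sum)
  have ikR: "i \<in> carrier R" "k \<in> carrier R" using ik closed right_ideal_closed(1)[OF K(1)] by auto
  \<comment> \<open>The intended extension sends i + k to f i + a k. Its value at 1 is the
    multiplier, so it suffices to check this one element on \<open>I\<close>.\<close>
  have "f x = (f i \<oplus> a \<otimes> k) \<otimes> x" if x: "x \<in> I" for x
  proof -
    have xR: "x \<in> carrier R" using x closed by blast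
    have dec: "x = i \<otimes> x \<oplus> k \<otimes> x" using ik(3) ikR xR by (metis l_distr l_one)
    have ix: "i \<otimes> x \<in> I" using ik(1) xR closed by blast
    \<comment> \<open>Since 1 = i + k, the element kx equals x - ix. It thus lies in
      \<open>I\<close> as well as in \<open>K\<close>, where \<open>f\<close> is multiplication by
      \<open>a\<close>.\<close>
    have "k \<otimes> x \<oplus> i \<otimes> x \<ominus> i \<otimes> x = k \<otimes> x"
      using ikR xR by (simp add: minus_eq a_assoc r_neg)
    moreover have "k \<otimes> x \<oplus> i \<otimes> x = x"
      using dec ikR xR a_comm[of "k \<otimes> x" "i \<otimes> x"] by simp
    ultimately have "k \<otimes> x = x \<ominus> i \<otimes> x" by simp
    then have kx: "k \<otimes> x \<in> I \<inter> K"
      using right_ideal_diff[OF I x ix] right_ideal_closed(4)[OF K(1) ik(2) xR] by simp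
    have "f x = f (i \<otimes> x) \<oplus> f (k \<otimes> x)" using f' ix kx dec by (metis IntD1)
    also have "\<dots> = f i \<otimes> x \<oplus> a \<otimes> (k \<otimes> x)" using f' ik(1) xR a(2)[OF kx] by simp
    also have "\<dots> = (f i \<oplus> a \<otimes> k) \<otimes> x"
      using fR[OF ik(1)] a(1) ikR xR by (simp add: l_distr m_assoc)
    finally show ?thesis .
  qed
  moreover have "f i \<oplus> a \<otimes> k \<in> carrier R" using fR[OF ik(1)] a(1) ikR by simp
  ultimately show "\<exists>c\<in>carrier R. \<forall>x\<in>I. f x = c \<otimes> x" by blast
qed

section \<open>The right singular ideal and its equality with the Jacobson radical\<close>

lemma minus_eq_zero_imp_eq:
  assumes "x \<ominus> y = \<zero>" "x \<in> carrier R" "y \<in> carrier R"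
  shows "x = y"
proof -
  have "x = x \<ominus> y \<oplus> y" using assms(2,3) by (simp add: minus_eq a_assoc l_neg)
  then show ?thesis using assms by simp
qed

text \<open>The right singular ideal: the condition says that the right annihilator of
  \<open>a\<close> is an essential right ideal.\<close>

definition right_singular :: "'a set" where
  "right_singular = {a \<in> carrier R. \<forall>K. right_ideal R K \<and> K \<noteq> {\<zero>} \<longrightarrow> (\<exists>k\<in>K. k \<noteq> \<zero> \<and> a \<otimes> k = \<zero>)}"

lemma right_singular_mult_left:
  assumes "z \<in> right_singular" "d \<in> carrier R"
  shows "d \<otimes> z \<in> right_singular"
proof -
  have z: "z \<in> carrier R" using assms(1) by (simp add: right_singular_def)
  have "\<exists>k\<in>K. k \<noteq> \<zero> \<and> d \<otimes> z \<otimes> k = \<zero>" if K: "right_ideal R K" "K \<noteq> {\<zero>}" for K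
  proof -
    obtain k where k: "k \<in> K" "k \<noteq> \<zero>" "z \<otimes> k = \<zero>"
      using assms(1) K unfolding right_singular_def by blast
    then have "k \<in> carrier R" using right_ideal_closed(1)[OF K(1)] by blast
    then have "d \<otimes> z \<otimes> k = \<zero>" using z assms(2) k(3) by (simp add: m_assoc)
    then show ?thesis using k by blast
  qed
  then show ?thesis using z assms(2) by (simp add: right_singular_def)
qed

text \<open>Given a non-zero \<open>K\<close>, consider dK. If dK = 0, any non-zero element of
  \<open>K\<close> will do; otherwise \<open>z\<close> kills some non-zero dk, and this
  \<open>k\<close> is non-zero.\<close>

lemma right_singular_mult_right:
  assumes zs: "z \<in> right_singular" and d: "d \<in> carrier R"
  shows "z \<otimes> d \<in> right_singular"
proof -
  have z: "z \<in> carrier R" using zs by (simp add: right_singular_def)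
  have "\<exists>k\<in>K. k \<noteq> \<zero> \<and> z \<otimes> d \<otimes> k = \<zero>" if K: "right_ideal R K" "K \<noteq> {\<zero>}" for K
  proof -
    note closed = right_ideal_closed[OF K(1)]
    let ?D = "(\<lambda>k. d \<otimes> k) ` K"
    have D: "right_ideal R ?D"
      unfolding right_ideal_char
    proof (intro conjI ballI)
      show "?D \<subseteq> carrier R" using closed(1) d by blast
      show "\<zero> \<in> ?D" using closed(2) d by (metis image_eqI r_null)
      fix x assume "x \<in> ?D"
      then obtain k where k: "k \<in> K" "x = d \<otimes> k" by blast
      {
        fix y assume "y \<in> ?D"
        then obtain l where l: "l \<in> K" "y = d \<otimes> l" by blast
        then have "x \<oplus> y = d \<otimes> (k \<oplus> l)" using k closed(1) d by (simp add: r_distr)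
        then show "x \<oplus> y \<in> ?D" using closed(3)[OF k(1) l(1)] by blast
      }
      fix r assume r: "r \<in> carrier R"
      then have "x \<otimes> r = d \<otimes> (k \<otimes> r)" using k closed(1) d by (simp add: m_assoc)
      then show "x \<otimes> r \<in> ?D" using closed(4)[OF k(1) r] by blast
    qed
    show ?thesis
    proof (cases "?D = {\<zero>}")
      case True
      obtain k where k: "k \<in> K" "k \<noteq> \<zero>" using K(2) closed(2) by blast
      have "d \<otimes> k = \<zero>" using True k(1) by blast
      then have "z \<otimes> d \<otimes> k = \<zero>" using z d closed(1)[OF k(1)] by (simp add: m_assoc)
      then show ?thesis using k by blast
    next
      case False
      then obtain y where "y \<in> ?D" "y \<noteq> \<zero>" "z \<otimes> y = \<zero>"
        using zs D unfolding right_singular_def by blast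
      then obtain k where k: "k \<in> K" "d \<otimes> k \<noteq> \<zero>" "z \<otimes> (d \<otimes> k) = \<zero>" by blast
      then have "k \<noteq> \<zero>" "z \<otimes> d \<otimes> k = \<zero>" using z d closed(1)[OF k(1)] by (auto simp: m_assoc)
      then show ?thesis using k(1) by blast
    qed
  qed
  then show ?thesis using z d by (simp add: right_singular_def)
qed

text \<open>Left multiplication by \<open>b\<close> is injective on \<open>K\<close>, so bk
  \<mapsto> k is a homomorphism on the right ideal bK. The element \<open>d\<close> that extends it
  undoes \<open>b\<close> on \<open>K\<close>.\<close>

lemma extends_left_inverse:
  assumes ext: "\<And>I. right_ideal R I \<Longrightarrow> extends_by_left_mult R I"
    and b: "b \<in> carrier R" and K: "right_ideal R K"
    and inj: "\<And>k. \<lbrakk>k \<in> K; b \<otimes> k = \<zero>\<rbrakk> \<Longrightarrow> k = \<zero>"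
  obtains d where "d \<in> carrier R" "\<And>k. k \<in> K \<Longrightarrow> d \<otimes> b \<otimes> k = k"
proof -
  note closed = right_ideal_closed[OF K]
  let ?B = "(\<lambda>k. b \<otimes> k) ` K"
  have inj_on: "inj_on (\<lambda>k. b \<otimes> k) K"
  proof (rule inj_onI)
    fix x y assume xy: "x \<in> K" "y \<in> K" "b \<otimes> x = b \<otimes> y"
    have c: "x \<in> carrier R" "y \<in> carrier R" using xy closed(1) by auto
    have "b \<otimes> (x \<ominus> y) = \<zero>" using xy(3) b c by (simp add: minus_eq r_distr r_minus r_neg)
    then have "x \<ominus> y = \<zero>" using inj right_ideal_diff[OF K xy(1,2)] by blast
    then show "x = y" using minus_eq_zero_imp_eq c by blast
  qed
  define f where "f = the_inv_into K (\<lambda>k. b \<otimes> k)"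
  have f: "f (b \<otimes> k) = k" if "k \<in> K" for k
    unfolding f_def using the_inv_into_f_f[OF inj_on that] by simp
  have add: "b \<otimes> k \<oplus> b \<otimes> l = b \<otimes> (k \<oplus> l)" if "k \<in> K" "l \<in> K" for k l
    using that closed(1) b by (simp add: r_distr)
  have mult: "b \<otimes> k \<otimes> r = b \<otimes> (k \<otimes> r)" if "k \<in> K" "r \<in> carrier R" for k r
    using that closed(1) b by (simp add: m_assoc)
  have B: "right_ideal R ?B"
    unfolding right_ideal_char
  proof (intro conjI ballI)
    show "?B \<subseteq> carrier R" using closed(1) b by blast
    show "\<zero> \<in> ?B" using closed(2) b by (metis image_eqI r_null)
    fix x assume x: "x \<in> ?B"
    show "x \<oplus> y \<in> ?B" if "y \<in> ?B" for y
      using x that add closed(3) by fastforce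
    show "x \<otimes> r \<in> ?B" if "r \<in> carrier R" for r
      using x that mult closed(4) by fastforce
  qed
  have "f \<in> right_hom R ((right_regular R)\<lparr>carrier := ?B\<rparr>) (right_regular R)"
    unfolding right_hom_ideal_iff
  proof (intro conjI ballI)
    show "f \<in> ?B \<rightarrow> carrier R" using f closed(1) by auto
    fix x assume x: "x \<in> ?B"
    then obtain k where k: "k \<in> K" "x = b \<otimes> k" by blast
    {
      fix y assume "y \<in> ?B"
      then obtain l where l: "l \<in> K" "y = b \<otimes> l" by blast
      show "f (x \<oplus> y) = f x \<oplus> f y"
        unfolding k(2) l(2) add[OF k(1) l(1)] f[OF k(1)] f[OF l(1)] f[OF closed(3)[OF k(1) l(1)]] ..
    }
    fix r assume r: "r \<in> carrier R"
    show "f (x \<otimes> r) = f x \<otimes> r"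
      unfolding k(2) mult[OF k(1) r] f[OF k(1)] f[OF closed(4)[OF k(1) r]] ..
  qed
  then obtain d where d: "d \<in> carrier R" "\<forall>x\<in>?B. f x = d \<otimes> x"
    using ext[OF B] unfolding extends_by_left_mult_def by blast
  have "d \<otimes> b \<otimes> k = k" if k: "k \<in> K" for k
  proof -
    have "d \<otimes> (b \<otimes> k) = k" using d(2) f[OF k] k by simp
    then show ?thesis using d(1) b closed(1)[OF k] by (simp add: m_assoc)
  qed
  then show ?thesis using that d(1) by blast
qed

lemma right_ideal_carrier: "right_ideal R (carrier R)"
  by (simp add: right_ideal_char)

text \<open>If (1 - z)k = 0, then \<open>z\<close> fixes kR elementwise, yet it must kill a non-zero
  element of kR unless k = 0. So 1 - z acts injectively on the whole ring and can be undone from the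
  left.\<close>

lemma one_minus_singular_left_inverse:
  assumes ext: "\<And>I. right_ideal R I \<Longrightarrow> extends_by_left_mult R I"
    and zs: "z \<in> right_singular"
  obtains d where "d \<in> carrier R" "d \<otimes> (\<one> \<ominus> z) = \<one>"
proof -
  have z: "z \<in> carrier R" using zs by (simp add: right_singular_def)
  have inj: "k = \<zero>" if k: "k \<in> carrier R" "(\<one> \<ominus> z) \<otimes> k = \<zero>" for k
  proof (rule ccontr)
    assume "k \<noteq> \<zero>"
    have "k \<ominus> z \<otimes> k = \<zero>" using k z by (simp add: minus_eq l_distr l_minus)
    then have zk: "z \<otimes> k = k" using minus_eq_zero_imp_eq[of k "z \<otimes> k"] k z by simp
    let ?K = "(\<lambda>r. k \<otimes> r) ` carrier R"
    have "right_ideal R ?K" "?K \<noteq> {\<zero>}"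
      using right_ideal_cyclic[OF k(1)] mem_right_cyclic[OF k(1)] \<open>k \<noteq> \<zero>\<close> by auto
    then obtain y where "y \<in> ?K" "y \<noteq> \<zero>" "z \<otimes> y = \<zero>"
      using zs unfolding right_singular_def by blast
    then obtain r where r: "r \<in> carrier R" "k \<otimes> r \<noteq> \<zero>" "z \<otimes> (k \<otimes> r) = \<zero>" by blast
    then have "z \<otimes> k \<otimes> r = \<zero>" using z k by (simp add: m_assoc)
    then show False using zk r by simp
  qed
  obtain d where d: "d \<in> carrier R" "\<And>k. k \<in> carrier R \<Longrightarrow> d \<otimes> (\<one> \<ominus> z) \<otimes> k = k"
    by (rule extends_left_inverse[OF ext _ right_ideal_carrier inj]) (use z in auto)
  from d(2)[of \<one>] have "d \<otimes> (\<one> \<ominus> z) = \<one>" using d(1) z by simp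
  then show ?thesis using that d(1) by blast
qed

text \<open>The radical asks for right inverses, but only left ones are at hand. A left inverse
  \<open>d\<close> of 1 - w, with w = zr, equals 1 - (-d)w and so has a left inverse
  \<open>c\<close> itself; then c = 1 - w, and \<open>d\<close> is a two-sided inverse.\<close>

lemma right_singular_subset_jacobson:
  assumes ext: "\<And>I. right_ideal R I \<Longrightarrow> extends_by_left_mult R I"
    and zs: "z \<in> right_singular"
  shows "z \<in> jacobson_radical R"
  unfolding jacobson_iff_right_inverse
proof (intro conjI ballI)
  show z: "z \<in> carrier R" using zs by (simp add: right_singular_def)
  fix r assume r: "r \<in> carrier R"
  have ws: "z \<otimes> r \<in> right_singular" using right_singular_mult_right[OF zs r] .
  let ?w = "z \<otimes> r"
  have w: "?w \<in> carrier R" using z r by simp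
  obtain d where d: "d \<in> carrier R" "d \<otimes> (\<one> \<ominus> ?w) = \<one>"
    using one_minus_singular_left_inverse[OF ext ws] .
  have "(\<ominus> d) \<otimes> ?w \<in> right_singular"
    using right_singular_mult_left[OF ws, of "\<ominus> d"] d(1) by simp
  then obtain c where c: "c \<in> carrier R" "c \<otimes> (\<one> \<ominus> (\<ominus> d) \<otimes> ?w) = \<one>"
    using one_minus_singular_left_inverse[OF ext] by blast
  have "d \<ominus> d \<otimes> ?w = \<one>" using d w by (simp add: minus_eq r_distr r_minus)
  then have "d \<ominus> d \<otimes> ?w \<oplus> d \<otimes> ?w = \<one> \<oplus> d \<otimes> ?w" by simp
  then have "\<one> \<ominus> (\<ominus> d) \<otimes> ?w = d" using d(1) w by (simp add: minus_eq l_minus a_assoc l_neg)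
  then have cd: "c \<otimes> d = \<one>" using c(2) by simp
  have "\<one> \<ominus> ?w = c \<otimes> d \<otimes> (\<one> \<ominus> ?w)" using cd w by simp
  also have "\<dots> = c" using c(1) d w by (simp only: m_assoc minus_closed one_closed r_one)
  finally show "\<exists>s\<in>carrier R. (\<one> \<ominus> z \<otimes> r) \<otimes> s = \<one>" using cd d(1) by metis
qed

text \<open>If \<open>a\<close> killed no non-zero element of some \<open>K\<close>, a left inverse
  \<open>d\<close> of \<open>a\<close> on \<open>K\<close> would give (1 - da)K = 0. Since 1 - da is
  a unit, \<open>K\<close> would be zero.\<close>

lemma jacobson_subset_right_singular:
  assumes ext: "\<And>I. right_ideal R I \<Longrightarrow> extends_by_left_mult R I"
    and a: "a \<in> jacobson_radical R"
  shows "a \<in> right_singular"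
proof -
  have aR: "a \<in> carrier R" using a by (simp add: jacobson_radical_def)
  have "\<exists>k\<in>K. k \<noteq> \<zero> \<and> a \<otimes> k = \<zero>" if K: "right_ideal R K" "K \<noteq> {\<zero>}" for K
  proof (rule ccontr)
    assume "\<not> ?thesis"
    then have inj: "\<And>k. \<lbrakk>k \<in> K; a \<otimes> k = \<zero>\<rbrakk> \<Longrightarrow> k = \<zero>" by blast
    obtain d where d: "d \<in> carrier R" "\<And>k. k \<in> K \<Longrightarrow> d \<otimes> a \<otimes> k = k"
      by (rule extends_left_inverse[OF ext aR K(1) inj]) (auto intro: that)
    have "\<one> \<ominus> d \<otimes> a \<in> Units R"
      using one_minus_jacobson_Units jacobson_mult_left[OF a d(1)] by blast
    then obtain v where v: "v \<in> carrier R" "v \<otimes> (\<one> \<ominus> d \<otimes> a) = \<one>" by (auto simp: Units_def)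
    have "k = \<zero>" if k: "k \<in> K" for k
    proof -
      have kR: "k \<in> carrier R" using right_ideal_closed(1)[OF K(1) k] .
      have "(\<one> \<ominus> d \<otimes> a) \<otimes> k = k \<ominus> d \<otimes> a \<otimes> k"
        using d(1) aR kR by (simp add: minus_eq l_distr l_minus)
      also have "\<dots> = \<zero>" unfolding d(2)[OF k] using kR by (simp add: minus_eq r_neg)
      finally have *: "(\<one> \<ominus> d \<otimes> a) \<otimes> k = \<zero>" .
      have "k = v \<otimes> (\<one> \<ominus> d \<otimes> a) \<otimes> k" using v kR by simp
      also have "\<dots> = v \<otimes> ((\<one> \<ominus> d \<otimes> a) \<otimes> k)"
        using v(1) d(1) aR kR by (intro m_assoc) auto
      also have "\<dots> = \<zero>" unfolding * using v(1) by simp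
      finally show ?thesis .
    qed
    then show False using K right_ideal_closed(2)[OF K(1)] by blast
  qed
  then show ?thesis using aR by (simp add: right_singular_def)
qed

section \<open>Complement right ideals and lifting of idempotents\<close>

text \<open>A right ideal that is a complement (here of \<open>F\<close>) in a right self-injective ring is generated
  by an idempotent: extend the projection \<open>E \<oplus> F \<rightarrow> E\<close> to left multiplication by
  \<open>h\<close>; since \<open>E\<close> is essential in \<open>h R\<close>, maximality forces \<open>h R = E\<close>.\<close>

lemma mutual_complements_projection:
  assumes ext: "\<And>I. right_ideal R I \<Longrightarrow> extends_by_left_mult R I"
    and E: "right_ideal R E" and F: "right_ideal R F" and EF: "E \<inter> F \<subseteq> {\<zero>}"
    and Emax: "\<And>E'. \<lbrakk>right_ideal R E'; E \<subseteq> E'; E' \<inter> F \<subseteq> {\<zero>}\<rbrakk> \<Longrightarrow> E' = E"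
    and Fmax: "\<And>F'. \<lbrakk>right_ideal R F'; F \<subseteq> F'; E \<inter> F' \<subseteq> {\<zero>}\<rbrakk> \<Longrightarrow> F' = F"
  obtains h where "h \<in> carrier R" "h \<otimes> h = h"
    "\<And>x. x \<in> E \<Longrightarrow> h \<otimes> x = x" "\<And>x. x \<in> F \<Longrightarrow> h \<otimes> x = \<zero>"
proof -
  note cE = right_ideal_closed[OF E] and cF = right_ideal_closed[OF F]
  let ?I = "E <+>\<^bsub>R\<^esub> F"
  have I: "right_ideal R ?I" using right_ideal_sum[OF E F] .
  have uniq: "e = e'" if *: "e \<in> E" "e' \<in> E" "f \<in> F" "f' \<in> F" "e \<oplus> f = e' \<oplus> f'" for e e' f f'
  proof -
    have cs: "e \<in> carrier R" "e' \<in> carrier R" "f \<in> carrier R" "f' \<in> carrier R"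
      using * cE(1) cF(1) by auto
    have "e \<ominus> e' = e \<oplus> f \<ominus> f \<ominus> e'" using cs by (simp add: minus_eq a_assoc r_neg)
    also have "\<dots> = e' \<oplus> f' \<ominus> f \<ominus> e'" using *(5) by simp
    also have "\<dots> = (f' \<ominus> f) \<oplus> (e' \<ominus> e')" using cs by (simp add: minus_eq a_ac)
    also have "\<dots> = f' \<ominus> f" using cs by (simp add: minus_eq r_neg)
    finally have "e \<ominus> e' \<in> E \<inter> F"
      using right_ideal_diff[OF E *(1,2)] right_ideal_diff[OF F *(4,3)] by simp
    then have "e \<ominus> e' = \<zero>" using EF by blast
    then show ?thesis using minus_eq_zero_imp_eq cs by blast
  qed
  define p where "p z = (THE e. e \<in> E \<and> (\<exists>f\<in>F. z = e \<oplus> f))" for z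
  have p: "p (e \<oplus> f) = e" if "e \<in> E" "f \<in> F" for e f
    unfolding p_def by (rule the_equality) (use that uniq in blast)+
  have "p \<in> right_hom R ((right_regular R)\<lparr>carrier := ?I\<rparr>) (right_regular R)"
    unfolding right_hom_ideal_iff
  proof (intro conjI ballI)
    show "p \<in> ?I \<rightarrow> carrier R" using p cE(1) by (auto simp: mem_ideal_sum)
    fix x assume "x \<in> ?I"
    then obtain e f where x: "e \<in> E" "f \<in> F" "x = e \<oplus> f" by (auto simp: mem_ideal_sum)
    have cs: "e \<in> carrier R" "f \<in> carrier R" using x cE(1) cF(1) by auto
    {
      fix y assume "y \<in> ?I"
      then obtain e' f' where y: "e' \<in> E" "f' \<in> F" "y = e' \<oplus> f'" by (auto simp: mem_ideal_sum)
      have cs': "e' \<in> carrier R" "f' \<in> carrier R" using y cE(1) cF(1) by auto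
      have "x \<oplus> y = (e \<oplus> e') \<oplus> (f \<oplus> f')" using x y cs cs' by (simp add: a_ac)
      then show "p (x \<oplus> y) = p x \<oplus> p y"
        using p[OF cE(3)[OF x(1) y(1)] cF(3)[OF x(2) y(2)]] p[OF x(1,2)] p[OF y(1,2)] x(3) y(3) by simp
    }
    fix r assume r: "r \<in> carrier R"
    have "x \<otimes> r = e \<otimes> r \<oplus> f \<otimes> r" using x cs r by (simp add: l_distr)
    then show "p (x \<otimes> r) = p x \<otimes> r"
      using p[OF cE(4)[OF x(1) r] cF(4)[OF x(2) r]] p[OF x(1,2)] x(3) by simp
  qed
  then obtain h where h: "h \<in> carrier R" "\<And>x. x \<in> ?I \<Longrightarrow> p x = h \<otimes> x"
    using ext[OF I] unfolding extends_by_left_mult_def by blast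
  have hE: "h \<otimes> x = x" if "x \<in> E" for x
    using p[OF that cF(2)] h(2)[of x] subset_ideal_sum(1)[OF E F] that cE(1)[OF that] by auto
  have hF: "h \<otimes> x = \<zero>" if "x \<in> F" for x
    using p[OF cE(2) that] h(2)[of x] subset_ideal_sum(2)[OF E F] that cF(1)[OF that] by auto
  let ?H = "(\<lambda>r. h \<otimes> r) ` carrier R"
  have H: "right_ideal R ?H" using right_ideal_cyclic[OF h(1)] .
  \<comment> \<open>Let y = hx be a non-zero element of \<open>F\<close>. As \<open>h\<close> kills
    \<open>F\<close>, \<open>x\<close> is outside \<open>F\<close>, so maximality of
    \<open>F\<close> yields a non-zero e = f + xr in \<open>E\<close>. Applying \<open>h\<close>
    gives e = yr, an element of both \<open>E\<close> and \<open>F\<close>.\<close>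
  have "y = \<zero>" if y: "y \<in> ?H \<inter> F" for y
  proof (rule ccontr)
    assume "y \<noteq> \<zero>"
    obtain x where x: "x \<in> carrier R" "y = h \<otimes> x" using y by blast
    have "x \<notin> F" using hF[of x] x \<open>y \<noteq> \<zero>\<close> by blast
    let ?X = "(\<lambda>r. x \<otimes> r) ` carrier R"
    have X: "right_ideal R ?X" using right_ideal_cyclic[OF x(1)] .
    have "F <+>\<^bsub>R\<^esub> ?X \<noteq> F"
      using subset_ideal_sum(2)[OF F X] mem_right_cyclic[OF x(1)] \<open>x \<notin> F\<close> by blast
    then have "\<not> E \<inter> (F <+>\<^bsub>R\<^esub> ?X) \<subseteq> {\<zero>}"
      using Fmax[OF right_ideal_sum[OF F X] subset_ideal_sum(1)[OF F X]] by blast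
    then obtain e where e: "e \<in> E" "e \<in> F <+>\<^bsub>R\<^esub> ?X" "e \<noteq> \<zero>" by blast
    then obtain f r where fr: "f \<in> F" "r \<in> carrier R" "e = f \<oplus> x \<otimes> r"
      unfolding mem_ideal_sum by blast
    have "e = h \<otimes> e" using hE[OF e(1)] by simp
    also have "\<dots> = h \<otimes> f \<oplus> h \<otimes> x \<otimes> r"
      using fr cF(1)[OF fr(1)] h(1) x(1) by (simp add: r_distr m_assoc)
    also have "\<dots> = y \<otimes> r" using hF[OF fr(1)] x h(1) fr(2) by simp
    finally have "e \<in> F" using y cF(4) fr(2) by blast
    then show False using e EF by blast
  qed
  then have "?H \<inter> F \<subseteq> {\<zero>}" by blast
  moreover have "E \<subseteq> ?H" using hE cE(1) by (metis image_eqI subsetI)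
  ultimately have "?H = E" using Emax[OF H] by blast
  \<comment> \<open>Idempotence is now immediate: \<open>h\<close> itself lies in \<open>E\<close>,
    and \<open>h\<close> fixes every element of \<open>E\<close>.\<close>
  then have "h \<in> E" using mem_right_cyclic[OF h(1)] by simp
  then show ?thesis using that[of h] h(1) hE hF by blast
qed

text \<open>First \<open>A\<close> is enlarged to \<open>E\<close>, maximal against
  \<open>B\<close>, then \<open>B\<close> to \<open>F\<close>, maximal against \<open>E\<close>.
  \<open>E\<close> remains maximal against \<open>F\<close>, because \<open>F\<close> contains
  \<open>B\<close> and so any right ideal meeting \<open>F\<close> trivially also meets
  \<open>B\<close> trivially.\<close>

lemma disjoint_right_ideals_projection:
  assumes ext: "\<And>I. right_ideal R I \<Longrightarrow> extends_by_left_mult R I"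
    and A: "right_ideal R A" and B: "right_ideal R B" and AB: "A \<inter> B \<subseteq> {\<zero>}"
  obtains h where "h \<in> carrier R" "h \<otimes> h = h"
    "\<And>x. x \<in> A \<Longrightarrow> h \<otimes> x = x" "\<And>x. x \<in> B \<Longrightarrow> h \<otimes> x = \<zero>"
proof -
  have "A \<inter> (B - {\<zero>}) = {}" using AB by blast
  from maximal_right_ideal_avoiding[OF A this] obtain E where
    E: "right_ideal R E" "A \<subseteq> E" "E \<inter> (B - {\<zero>}) = {}"
      "\<And>K. \<lbrakk>right_ideal R K; E \<subseteq> K; K \<inter> (B - {\<zero>}) = {}\<rbrakk> \<Longrightarrow> K = E" by blast
  have "B \<inter> (E - {\<zero>}) = {}" using E(3) by blast
  from maximal_right_ideal_avoiding[OF B this] obtain F where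
    F: "right_ideal R F" "B \<subseteq> F" "F \<inter> (E - {\<zero>}) = {}"
      "\<And>K. \<lbrakk>right_ideal R K; F \<subseteq> K; K \<inter> (E - {\<zero>}) = {}\<rbrakk> \<Longrightarrow> K = F" by blast
  have EF: "E \<inter> F \<subseteq> {\<zero>}" using F(3) by blast
  have Emax: "X = E" if "right_ideal R X" "E \<subseteq> X" "X \<inter> F \<subseteq> {\<zero>}" for X
    using that F(2) by (intro E(4)) auto
  have Fmax: "X = F" if "right_ideal R X" "F \<subseteq> X" "E \<inter> X \<subseteq> {\<zero>}" for X
    using that by (intro F(4)) auto
  show ?thesis
    by (rule mutual_complements_projection[OF ext E(1) F(1) EF Emax Fmax])
      (use E(2) F(2) in \<open>auto intro!: that\<close>)
qed

lemma extends_idempotent_lifting: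
  assumes ext: "\<And>I. right_ideal R I \<Longrightarrow> extends_by_left_mult R I"
    and a: "a \<in> carrier R" and aJ: "a \<otimes> a \<ominus> a \<in> jacobson_radical R"
  obtains e where "e \<in> carrier R" "e \<otimes> e = e" "e \<ominus> a \<in> jacobson_radical R"
proof -
  have sing: "a \<otimes> a \<ominus> a \<in> right_singular"
    using jacobson_subset_right_singular[OF ext aJ] .
  \<comment> \<open>This is the right annihilator of a^2 - a, which is essential since a^2 - a is
    right singular.\<close>
  let ?K = "{x \<in> carrier R. a \<otimes> (a \<otimes> x) = a \<otimes> x}"
  let ?A = "(\<lambda>x. a \<otimes> x) ` ?K" and ?B = "(\<lambda>x. x \<ominus> a \<otimes> x) ` ?K"
  have K_add: "x \<oplus> y \<in> ?K" if "x \<in> ?K" "y \<in> ?K" for x y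
    using that a by (simp add: r_distr)
  have K_mult: "x \<otimes> r \<in> ?K" if "x \<in> ?K" "r \<in> carrier R" for x r
  proof -
    have x: "x \<in> carrier R" "a \<otimes> (a \<otimes> x) = a \<otimes> x" using that(1) by blast+
    have "a \<otimes> (a \<otimes> (x \<otimes> r)) = a \<otimes> (a \<otimes> x) \<otimes> r"
      using x(1) that(2) a by (simp add: m_assoc)
    also have "\<dots> = a \<otimes> (x \<otimes> r)" unfolding x(2) using x(1) that(2) a by (simp add: m_assoc)
    finally show ?thesis using x(1) that(2) by simp
  qed
  have K0: "\<zero> \<in> ?K" using a by simp
  have lin: "right_ideal R (g ` ?K)"
    if g: "\<And>x. x \<in> ?K \<Longrightarrow> g x \<in> carrier R" "g \<zero> = \<zero>"
      "\<And>x y. \<lbrakk>x \<in> ?K; y \<in> ?K\<rbrakk> \<Longrightarrow> g (x \<oplus> y) = g x \<oplus> g y"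
      "\<And>x r. \<lbrakk>x \<in> ?K; r \<in> carrier R\<rbrakk> \<Longrightarrow> g (x \<otimes> r) = g x \<otimes> r" for g
    unfolding right_ideal_char
  proof (intro conjI ballI)
    show "g ` ?K \<subseteq> carrier R" using g(1) by blast
    show "\<zero> \<in> g ` ?K" using K0 g(2) by (metis (no_types, lifting) image_eqI)
    fix u assume "u \<in> g ` ?K"
    then obtain x where x: "x \<in> ?K" "u = g x" by blast
    {
      fix v assume "v \<in> g ` ?K"
      then obtain y where y: "y \<in> ?K" "v = g y" by blast
      show "u \<oplus> v \<in> g ` ?K"
        unfolding x(2) y(2) g(3)[OF x(1) y(1), symmetric] by (rule imageI[OF K_add[OF x(1) y(1)]])
    }
    fix r assume r: "r \<in> carrier R"
    show "u \<otimes> r \<in> g ` ?K"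
      unfolding x(2) g(4)[OF x(1) r, symmetric] by (rule imageI[OF K_mult[OF x(1) r]])
  qed
  have A: "right_ideal R ?A"
    by (rule lin) (use a in \<open>simp_all add: r_distr m_assoc\<close>)
  have B: "right_ideal R ?B"
    by (rule lin) (use a in \<open>simp_all add: minus_eq r_distr m_assoc minus_add a_ac l_distr l_minus\<close>)
  \<comment> \<open>Multiplication by \<open>a\<close> fixes every element of \<open>?A\<close> and
    kills every element of \<open>?B\<close>.\<close>
  have AB: "?A \<inter> ?B \<subseteq> {\<zero>}"
  proof
    fix z assume z: "z \<in> ?A \<inter> ?B"
    then obtain x where x: "x \<in> carrier R" "a \<otimes> (a \<otimes> x) = a \<otimes> x" "z = a \<otimes> x" by blast
    obtain y where y: "y \<in> carrier R" "a \<otimes> (a \<otimes> y) = a \<otimes> y" "z = y \<ominus> a \<otimes> y" using z by blast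
    have "z = a \<otimes> z" using x by simp
    also have "\<dots> = a \<otimes> y \<ominus> a \<otimes> (a \<otimes> y)" using y(1,3) a by (simp add: minus_eq r_distr r_minus)
    also have "\<dots> = \<zero>" unfolding y(2) using y(1) a by (simp add: minus_eq r_neg)
    finally show "z \<in> {\<zero>}" by simp
  qed
  obtain h where h: "h \<in> carrier R" "h \<otimes> h = h"
    "\<And>x. x \<in> ?A \<Longrightarrow> h \<otimes> x = x" "\<And>x. x \<in> ?B \<Longrightarrow> h \<otimes> x = \<zero>"
    by (rule disjoint_right_ideals_projection[OF ext A B AB]) (assumption | rule that)+
  \<comment> \<open>Split x = ax + (x - ax): \<open>h\<close> fixes the first summand and kills the
    second, so hx = ax.\<close>
  have hK: "(h \<ominus> a) \<otimes> x = \<zero>" if x: "x \<in> ?K" for x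
  proof -
    have xR: "x \<in> carrier R" using x by blast
    have 1: "h \<otimes> (a \<otimes> x) = a \<otimes> x" and 2: "h \<otimes> (x \<ominus> a \<otimes> x) = \<zero>"
      using h(3,4) x by blast+
    have "h \<otimes> x \<ominus> h \<otimes> (a \<otimes> x) = \<zero>"
      using 2 xR a h(1) by (simp add: minus_eq r_distr r_minus)
    then have "h \<otimes> x \<ominus> a \<otimes> x = \<zero>" unfolding 1 .
    then show ?thesis using xR a h(1) by (simp add: minus_eq l_distr l_minus)
  qed
  \<comment> \<open>A non-zero \<open>L\<close> contains a non-zero element killed by a^2 - a. That
    element is in \<open>?K\<close>, hence is killed by h - a; so h - a is right singular and lies
    in the radical.\<close>
  have "\<exists>k\<in>L. k \<noteq> \<zero> \<and> (h \<ominus> a) \<otimes> k = \<zero>" if L: "right_ideal R L" "L \<noteq> {\<zero>}" for L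
  proof -
    obtain k where k: "k \<in> L" "k \<noteq> \<zero>" "(a \<otimes> a \<ominus> a) \<otimes> k = \<zero>"
      using sing L unfolding right_singular_def by blast
    have kR: "k \<in> carrier R" using right_ideal_closed(1)[OF L(1) k(1)] .
    have "a \<otimes> (a \<otimes> k) \<ominus> a \<otimes> k = \<zero>"
      using k(3) kR a by (simp add: minus_eq l_distr l_minus m_assoc)
    then have "k \<in> ?K" using minus_eq_zero_imp_eq kR a by simp
    then show ?thesis using hK k by blast
  qed
  then have "h \<ominus> a \<in> right_singular" using h(1) a by (simp add: right_singular_def)
  then show ?thesis
    using that h(1,2) right_singular_subset_jacobson[OF ext] by blast
qed

end

section \<open>Direct products and Baer's criterion\<close>

definition direct_product ::
  "('a, 'm, 'c) module_scheme \<Rightarrow> ('a, 'n, 'd) module_scheme \<Rightarrow> ('a, 'm \<times> 'n) module" where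
  "direct_product M N =
     \<lparr>carrier = carrier M \<times> carrier N, mult = undefined, one = undefined,
      zero = (\<zero>\<^bsub>M\<^esub>, \<zero>\<^bsub>N\<^esub>), add = (\<lambda>p q. (fst p \<oplus>\<^bsub>M\<^esub> fst q, snd p \<oplus>\<^bsub>N\<^esub> snd q)),
      smult = (\<lambda>r p. (r \<odot>\<^bsub>M\<^esub> fst p, r \<odot>\<^bsub>N\<^esub> snd p))\<rparr>"

lemma direct_product_simps [simp]:
  "carrier (direct_product M N) = carrier M \<times> carrier N"
  "\<zero>\<^bsub>direct_product M N\<^esub> = (\<zero>\<^bsub>M\<^esub>, \<zero>\<^bsub>N\<^esub>)"
  "p \<oplus>\<^bsub>direct_product M N\<^esub> q = (fst p \<oplus>\<^bsub>M\<^esub> fst q, snd p \<oplus>\<^bsub>N\<^esub> snd q)"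
  "r \<odot>\<^bsub>direct_product M N\<^esub> p = (r \<odot>\<^bsub>M\<^esub> fst p, r \<odot>\<^bsub>N\<^esub> snd p)"
  by (simp_all add: direct_product_def)

lemma right_module_direct_product:
  assumes "right_module R M" "right_module R N"
  shows "right_module R (direct_product M N)"
proof -
  interpret M: right_module R M by fact
  interpret N: right_module R N by fact
  have "\<exists>q\<in>carrier (direct_product M N). q \<oplus>\<^bsub>direct_product M N\<^esub> p = \<zero>\<^bsub>direct_product M N\<^esub>"
    if "p \<in> carrier (direct_product M N)" for p
    using that M.M.l_neg N.M.l_neg by (intro bexI[of _ "(\<ominus>\<^bsub>M\<^esub> fst p, \<ominus>\<^bsub>N\<^esub> snd p)"]) auto
  then have "abelian_group (direct_product M N)"
    by (intro abelian_groupI) (auto simp: M.M.a_ac N.M.a_ac)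
  moreover have "right_module_axioms R (direct_product M N)"
    by unfold_locales
      (auto simp: M.smult_closed N.smult_closed M.smult_add_scalar N.smult_add_scalar
        M.smult_add N.smult_add M.smult_mult N.smult_mult M.smult_one N.smult_one)
  ultimately show ?thesis by (intro right_module.intro M.ring_axioms)
qed

text \<open>Baer's criterion.  A homomorphism is handled as its graph, a submodule of \<open>M \<times> R\<close>; a
  submodule is the graph of a partial homomorphism iff it avoids all \<open>(0, y)\<close> with
  \<open>y \<noteq> 0\<close>, so Zorn's lemma for submodules avoiding a set applies.\<close>

lemma (in ring) Baer_criterion:
  assumes ext: "\<And>I. right_ideal R I \<Longrightarrow> extends_by_left_mult R I"
  shows "injective_module TYPE('m) R (right_regular R)"
  unfolding injective_module_def
proof (intro conjI allI impI ballI)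
  show "right_module R (right_regular R)" by (rule right_module_regular) (rule ring_axioms)
next
  fix M :: "('a, 'm) module" and N f
  assume MN: "right_module R M \<and> right_submodule R M N"
    and f: "f \<in> right_hom R (M\<lparr>carrier := N\<rparr>) (right_regular R)"
  interpret M: right_module R M using MN by blast
  let ?P = "direct_product M (right_regular R)"
  interpret P: right_module R ?P
    by (rule right_module_direct_product[OF M.right_module_axioms regular.right_module_axioms])
  have N: "N \<subseteq> carrier M" "\<zero>\<^bsub>M\<^esub> \<in> N" "\<And>x y. \<lbrakk>x \<in> N; y \<in> N\<rbrakk> \<Longrightarrow> x \<oplus>\<^bsub>M\<^esub> y \<in> N"
    "\<And>r x. \<lbrakk>r \<in> carrier R; x \<in> N\<rbrakk> \<Longrightarrow> r \<odot>\<^bsub>M\<^esub> x \<in> N"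
    using MN by (simp_all add: M.submodule_iff)
  have fR: "\<And>x. x \<in> N \<Longrightarrow> f x \<in> carrier R"
    and f_add: "\<And>x y. \<lbrakk>x \<in> N; y \<in> N\<rbrakk> \<Longrightarrow> f (x \<oplus>\<^bsub>M\<^esub> y) = f x \<oplus> f y"
    and f_smult: "\<And>r x. \<lbrakk>r \<in> carrier R; x \<in> N\<rbrakk> \<Longrightarrow> f (r \<odot>\<^bsub>M\<^esub> x) = f x \<otimes> r"
    using f by (simp_all add: right_hom_def Pi_iff)
  have f0: "f \<zero>\<^bsub>M\<^esub> = \<zero>"
    using f_smult[of \<zero> "\<zero>\<^bsub>M\<^esub>"] N(2) fR[OF N(2)] by (simp add: M.smult_zero_scalar)
  let ?G0 = "(\<lambda>x. (x, f x)) ` N" and ?C = "{(\<zero>\<^bsub>M\<^esub>, y) | y. y \<noteq> \<zero>}"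
  have G0: "right_submodule R ?P ?G0"
    unfolding P.submodule_iff
  proof (intro conjI ballI)
    show "?G0 \<subseteq> carrier ?P" using N(1) fR by auto
    show "\<zero>\<^bsub>?P\<^esub> \<in> ?G0" using N(2) f0 by force
    fix p assume p: "p \<in> ?G0"
    show "p \<oplus>\<^bsub>?P\<^esub> q \<in> ?G0" if "q \<in> ?G0" for q
      using p that f_add N(3) by auto
    show "r \<odot>\<^bsub>?P\<^esub> p \<in> ?G0" if "r \<in> carrier R" for r
      using p that f_smult N(4) by auto
  qed
  have "?G0 \<inter> ?C = {}" using f0 by auto
  from P.maximal_submodule_avoiding[OF G0 this] obtain G where
    G: "right_submodule R ?P G" "?G0 \<subseteq> G" "G \<inter> ?C = {}"
      "\<And>K. \<lbrakk>right_submodule R ?P K; G \<subseteq> K; K \<inter> ?C = {}\<rbrakk> \<Longrightarrow> K = G" by blast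
  have G_closed: "G \<subseteq> carrier M \<times> carrier R"
    "\<And>x y x' y'. \<lbrakk>(x, y) \<in> G; (x', y') \<in> G\<rbrakk> \<Longrightarrow> (x \<oplus>\<^bsub>M\<^esub> x', y \<oplus> y') \<in> G"
    "\<And>r x y. \<lbrakk>r \<in> carrier R; (x, y) \<in> G\<rbrakk> \<Longrightarrow> (r \<odot>\<^bsub>M\<^esub> x, y \<otimes> r) \<in> G"
    "(\<zero>\<^bsub>M\<^esub>, \<zero>) \<in> G"
    using G(1) unfolding P.submodule_iff by force+
  have G_carrier: "x \<in> carrier M" "y \<in> carrier R" if "(x, y) \<in> G" for x y
    using that G_closed(1) by auto
  have G_minus: "(\<ominus>\<^bsub>M\<^esub> x, \<ominus> y) \<in> G" if "(x, y) \<in> G" for x y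
    using G_closed(3)[of "\<ominus> \<one>", OF _ that] G_carrier[OF that]
    by (simp add: M.smult_minus_one r_minus)
  \<comment> \<open>Two values at the same \<open>x\<close> differ by some y - y' with (0, y - y')
    in \<open>G\<close>, which avoids \<open>?C\<close>.\<close>
  have single: "y = y'" if "(x, y) \<in> G" "(x, y') \<in> G" for x y y'
  proof -
    have "(\<zero>\<^bsub>M\<^esub>, y \<ominus> y') \<in> G"
      using G_closed(2)[OF that(1) G_minus[OF that(2)]] G_carrier[OF that(1)]
      by (simp add: M.M.r_neg minus_eq)
    then have "y \<ominus> y' = \<zero>" using G(3) by blast
    then show ?thesis using minus_eq_zero_imp_eq G_carrier that by blast
  qed
  define g where "g x = (THE y. (x, y) \<in> G)" for x
  have g: "g x = y" if "(x, y) \<in> G" for x y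
    unfolding g_def using that single by blast
  \<comment> \<open>The scalars that carry \<open>x\<close> into the domain of \<open>G\<close> form
    a right ideal, and r \<mapsto> g(xr) is a homomorphism on it. Its multiplier \<open>c\<close> is
    a consistent value at \<open>x\<close>, so maximality of \<open>G\<close> forces (x, c) into
    \<open>G\<close>.\<close>
  have total: "\<exists>y. (x, y) \<in> G" if x: "x \<in> carrier M" for x
  proof -
    let ?I = "{r \<in> carrier R. \<exists>y. (r \<odot>\<^bsub>M\<^esub> x, y) \<in> G}"
    let ?h = "\<lambda>r. g (r \<odot>\<^bsub>M\<^esub> x)"
    have Iadd: "((r \<oplus> s) \<odot>\<^bsub>M\<^esub> x, y \<oplus> y') \<in> G"
      if "r \<in> carrier R" "s \<in> carrier R" "(r \<odot>\<^bsub>M\<^esub> x, y) \<in> G" "(s \<odot>\<^bsub>M\<^esub> x, y') \<in> G" for r s y y'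
      using G_closed(2)[OF that(3,4)] that(1,2) x by (simp add: M.smult_add_scalar)
    have Imult: "((r \<otimes> s) \<odot>\<^bsub>M\<^esub> x, y \<otimes> s) \<in> G"
      if "r \<in> carrier R" "s \<in> carrier R" "(r \<odot>\<^bsub>M\<^esub> x, y) \<in> G" for r s y
      using G_closed(3)[OF that(2,3)] that(1,2) x by (simp add: M.smult_mult)
    have I: "right_ideal R ?I"
      unfolding right_ideal_char
    proof (intro conjI ballI)
      show "?I \<subseteq> carrier R" by blast
      show "\<zero> \<in> ?I" using G_closed(4) x M.smult_zero_scalar by auto
      fix r assume r: "r \<in> ?I"
      show "r \<oplus> s \<in> ?I" if "s \<in> ?I" for s using r that Iadd by blast
      show "r \<otimes> s \<in> ?I" if "s \<in> carrier R" for s using r that Imult by blast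
    qed
    have h: "?h \<in> right_hom R ((right_regular R)\<lparr>carrier := ?I\<rparr>) (right_regular R)"
      unfolding right_hom_ideal_iff
    proof (intro conjI ballI)
      show "?h \<in> ?I \<rightarrow> carrier R" using g G_carrier(2) by auto
      fix r assume "r \<in> ?I"
      then obtain y where r: "r \<in> carrier R" "(r \<odot>\<^bsub>M\<^esub> x, y) \<in> G" by blast
      {
        fix s assume "s \<in> ?I"
        then obtain y' where s: "s \<in> carrier R" "(s \<odot>\<^bsub>M\<^esub> x, y') \<in> G" by blast
        show "?h (r \<oplus> s) = ?h r \<oplus> ?h s"
          unfolding g[OF Iadd[OF r(1) s(1) r(2) s(2)]] g[OF r(2)] g[OF s(2)] ..
      }
      fix s assume s: "s \<in> carrier R"
      show "?h (r \<otimes> s) = ?h r \<otimes> s"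
        unfolding g[OF Imult[OF r(1) s r(2)]] g[OF r(2)] ..
    qed
    obtain c where c: "c \<in> carrier R" "\<forall>r\<in>?I. ?h r = c \<otimes> r"
      using bspec[OF ext[OF I, unfolded extends_by_left_mult_def] h] by (rule bexE)
    let ?X = "(\<lambda>r. r \<odot>\<^bsub>?P\<^esub> (x, c)) ` carrier R"
    have xc: "(x, c) \<in> carrier ?P" using x c(1) by simp
    note X = P.cyclic_submodule[OF xc]
    \<comment> \<open>Suppose (z, y) + (x, c)r has first component 0. Then xr = -z is in the domain,
      with value -y from \<open>G\<close> and value cr by the choice of \<open>c\<close>; so the
      second component y + cr is 0 too.\<close>
    have "(G <+>\<^bsub>?P\<^esub> ?X) \<inter> ?C = {}"
    proof (rule ccontr)
      assume "(G <+>\<^bsub>?P\<^esub> ?X) \<inter> ?C \<noteq> {}"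
      then obtain p where p: "p \<in> G <+>\<^bsub>?P\<^esub> ?X" "p \<in> ?C" by blast
      then obtain q r where qr: "q \<in> G" "r \<in> carrier R" "p = q \<oplus>\<^bsub>?P\<^esub> (r \<odot>\<^bsub>?P\<^esub> (x, c))"
        unfolding P.mem_set_add by blast
      obtain z y where q: "q = (z, y)" by (cases q)
      have zy: "(z, y) \<in> G" using qr(1) q by simp
      note zyc = G_carrier[OF zy]
      have p0: "z \<oplus>\<^bsub>M\<^esub> r \<odot>\<^bsub>M\<^esub> x = \<zero>\<^bsub>M\<^esub>" "y \<oplus> c \<otimes> r \<noteq> \<zero>"
        using p(2) qr(3) q by auto
      have "r \<odot>\<^bsub>M\<^esub> x = \<ominus>\<^bsub>M\<^esub> z"
        using p0(1) zyc(1) x qr(2) M.smult_closed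
        by (metis M.M.minus_equality M.M.a_comm)
      then have rG: "(r \<odot>\<^bsub>M\<^esub> x, \<ominus> y) \<in> G" using G_minus[OF zy] by simp
      then have "c \<otimes> r = \<ominus> y" using c(2) g[OF rG] qr(2) by auto
      then show False using p0(2) zyc(2) by (simp add: r_neg)
    qed
    then have "G <+>\<^bsub>?P\<^esub> ?X = G"
      using G(4) P.submodule_set_add[OF G(1) X] P.subset_set_add(1)[OF G(1) X] by blast
    then have "(x, c) \<in> G" using P.subset_set_add(2)[OF G(1) X] P.mem_cyclic[OF xc] by blast
    then show ?thesis ..
  qed
  have gG: "(x, g x) \<in> G" if "x \<in> carrier M" for x
    using total[OF that] g by metis
  show "\<exists>g\<in>right_hom R M (right_regular R). \<forall>x\<in>N. g x = f x"
  proof (intro bexI[of _ g] ballI)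
    show "g x = f x" if "x \<in> N" for x using g G(2) that by blast
    have "g x \<in> carrier R" if "x \<in> carrier M" for x
      using G_carrier(2)[OF gG[OF that]] .
    moreover have "g (x \<oplus>\<^bsub>M\<^esub> y) = g x \<oplus> g y" if "x \<in> carrier M" "y \<in> carrier M" for x y
      using g[OF G_closed(2)[OF gG[OF that(1)] gG[OF that(2)]]] .
    moreover have "g (r \<odot>\<^bsub>M\<^esub> x) = g x \<otimes> r" if "r \<in> carrier R" "x \<in> carrier M" for r x
      using g[OF G_closed(3)[OF that(1) gG[OF that(2)]]] .
    ultimately show "g \<in> right_hom R M (right_regular R)"
      by (simp add: right_hom_def)
  qed
qed

section \<open>From self-injectivity back to right ideals, and the equivalence\<close>

text \<open>Injectivity is tested on modules over the type \<open>'a + 'm\<close>, so the regular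
  module is copied along \<open>Inl\<close> and the homomorphism is carried over by
  \<open>projl\<close>.\<close>

lemma (in ring) self_injective_extends:
  assumes inj: "right_self_injective TYPE('m) R" and I: "right_ideal R I"
  shows "extends_by_left_mult R I"
proof -
  have IR: "I \<subseteq> carrier R" using right_ideal_closed(1)[OF I] by blast
  let ?M = "\<lparr>carrier = Inl ` carrier R, mult = undefined, one = undefined, zero = Inl \<zero>,
    add = (\<lambda>x y. Inl (projl x \<oplus> projl y)), smult = (\<lambda>r x. Inl (projl x \<otimes> r))\<rparr>
    :: ('a, 'a + 'm) module"
  have "\<exists>y\<in>carrier ?M. y \<oplus>\<^bsub>?M\<^esub> x = \<zero>\<^bsub>?M\<^esub>" if "x \<in> carrier ?M" for x
    using that by (intro bexI[of _ "Inl (\<ominus> projl x)"]) (auto simp: l_neg)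
  then have "abelian_group ?M"
    by (intro abelian_groupI) (auto simp: a_ac)
  moreover have "right_module_axioms R ?M"
    by unfold_locales (auto simp: l_distr r_distr m_assoc)
  ultimately have M: "right_module R ?M" by (intro right_module.intro ring_axioms)
  interpret M: right_module R ?M by (rule M)
  have sub: "right_submodule R ?M (Inl ` I)"
    unfolding M.submodule_iff using I unfolding right_ideal_char by auto
  show ?thesis
    unfolding extends_by_left_mult_iff[OF IR]
  proof
    fix f assume "f \<in> right_hom R ((right_regular R)\<lparr>carrier := I\<rparr>) (right_regular R)"
    then have f: "(\<lambda>x. f (projl x)) \<in> right_hom R (?M\<lparr>carrier := Inl ` I\<rparr>) (right_regular R)"
      unfolding right_hom_ideal_iff by (auto simp: right_hom_def)
    from inj have "\<exists>g\<in>right_hom R ?M (right_regular R). \<forall>x\<in>Inl ` I. g x = f (projl x)"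
      unfolding right_self_injective_def injective_module_def
      using M sub f by (elim conjE allE[of _ ?M] allE[of _ "Inl ` I"] impE) (simp, erule (1) bspec)
    then obtain g where g: "g \<in> right_hom R ?M (right_regular R)" "\<forall>x\<in>Inl ` I. g x = f (projl x)"
      by (rule bexE)
    have "(\<lambda>x. g (Inl x)) \<in> right_hom R (right_regular R) (right_regular R)"
      using g(1) by (auto simp: right_hom_def)
    then show "\<exists>g\<in>right_hom R (right_regular R) (right_regular R). \<forall>x\<in>I. g x = f x"
      using g(2) by (intro bexI[of _ "\<lambda>x. g (Inl x)"]) auto
  qed
qed

theorem theorem3p7:
  fixes R :: "('a, 'b) ring_scheme"
  assumes "ring R"
  shows "right_PF TYPE('m) R \<longleftrightarrow>
    semilocal R \<and> right_small_injective R \<and>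
    essential_submodule R (right_regular R) (right_socle R)"
proof -
  interpret ring R by (rule assms)
  show ?thesis
  proof
    assume PF: "right_PF TYPE('m) R"
    then have "right_small_injective R"
      using self_injective_extends[where 'm = 'm]
      by (auto simp: right_small_injective_iff right_PF_def small_right_ideal_def)
    then show "semilocal R \<and> right_small_injective R \<and>
        essential_submodule R (right_regular R) (right_socle R)"
      using PF by (simp add: right_PF_def semiperfect_def)
  next
    assume R: "semilocal R \<and> right_small_injective R \<and>
      essential_submodule R (right_regular R) (right_socle R)"
    \<comment> \<open>Extension from all right ideals is the only consequence of small injectivity
      that is used: it gives self-injectivity by Baer's criterion and the lifting of idempotents
      that turns semilocal into semiperfect.\<close>
    then have ext: "extends_by_left_mult R I" if "right_ideal R I" for I
      using semilocal_small_injective_extends that by blast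
    have "right_self_injective TYPE('m) R"
      unfolding right_self_injective_def by (rule Baer_criterion[OF ext])
    moreover have "semiperfect R"
      unfolding semiperfect_def using R extends_idempotent_lifting[OF ext] by metis
    ultimately show "right_PF TYPE('m) R" using R by (simp add: right_PF_def)
  qed
qed

end
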